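(* (Armature Lemma.) Let $\lambda$ be an infinite cardinal, let $P$ be a poset with a $\lambda$-lifter $(X,\mathbf{X})$, let $\mathcal{A}$ and $\mathcal{S}$ be categories, and let $\Phi\colon\mathcal{A}\to\mathcal{S}$ be a functor. Suppose that $\mathcal{A}$ has all small directed colimits, that any two objects of $\mathcal{A}$ have a product in $\mathcal{A}$, and that $\Phi$ preserves all small directed colimits. Let $\overrightarrow{A}=(A_p,\alpha_p^q\mid p\le q\text{ in }P)$ be a $P$-indexed diagram in $\mathcal{A}$, let $S$ be an object of $\mathcal{S}$, let $\chi\colon S\to\Phi\bigl(\mathbf{F}(X)\otimes\overrightarrow{A}\bigr)$ be a morphism of $\mathcal S$, and let $\bigl((S_{\mathbf{x}},\varphi_{\mathbf{x}}),\varphi_{\mathbf{x}}^{\mathbf{y}}\mid\mathbf{x}\subseteq\mathbf{y}\text{ in }\mathbf{X}\bigr)$ be an $\mathbf{X}$-indexed diagram in the comma category $\mathcal{S}\downarrow S$ (so $\varphi_{\mathbf x}\colon S_{\mathbf x}\to S$) such that $S_{\mathbf{x}}$ is weakly $\lambda$-presented in $\mathcal S$ for each $\mathbf{x}\in\mathbf{X}^{=}$. Set $\rho_{\mathbf{x}}:=\Phi\bigl(\pi^X_{\mathbf{x}}\otimes\overrightarrow{A}\bigr)\circ\chi$ for each $\mathbf{x}\in\mathbf{X}$. Then there exists an isotone section $\sigma\colon P\hookrightarrow\mathbf{X}$ of the lifter (i.e., $\sigma$ is isotone and $\partial\sigma(p)=p$ for each $p\in P$) such that the family $(\rho_{\sigma(p)}\circ\varphi_{\sigma(p)}\mid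 p\in P)$ is a natural transformation from $(S_{\sigma(p)},\varphi_{\sigma(p)}^{\sigma(q)}\mid p\le q\text{ in }P)$ to $\Phi\overrightarrow{A}$.
   Context: **Posets.** All posets are nonempty. A set is $\kappa$-small if its cardinality is $<\kappa$; $[X]^{<\kappa}$ is the set of all $\kappa$-small subsets of $X$. For a subset $Y$ of a poset $P$, $\nabla Y$ is the set of all minimal elements of the set of upper bounds of $Y$ in $P$, and $u\mathbin{\nabla}v=\nabla\{u,v\}$. $P$ is a *pseudo join-semilattice* if for every $Y\subseteq P$ that is empty or has two elements, the set of upper bounds of $Y$ is of the form $\{p\mid(\exists f\in F)(f\le p)\}$ for a finite $F\subseteq P$. $Z\subseteq P$ is *$\nabla$-closed* if $\nabla Y\subseteq Z$ for each finite $Y\subseteq Z$; $P$ is *supported* if it is a pseudo join-semilattice and the $\nabla$-closure (least $\nabla$-closed superset) of each finite subset is finite. An *ideal* of a poset is a nonempty directed lower subset. A poset-indexed diagram is a functor from the poset, viewed as a category. **Lifters.** A *norm-covering* of $P$ is a pair $(X,\partial)$ (written $X$) with $X$ a pseudo join-semilattice and $\partial\colon X\to P$ isotone. An ideal $\mathbf{u}$ of $X$ is *sharp* if $\{\partial x\mid x\in\mathbf{u}\}$ has a largest element, denoted $\partial\mathbf{u}$; $\mathrm{Id}_s X$ is the set of sharp ideals, ordered by inclusion. A *$\lambda$-lifter* of $P$ is a pair $(X,\mathbf{X})$, $X$ a norm-covering of $P$, $\mathbf{X}\subseteq\mathrm{Id}_sX$, such that, setting $\mathbf{X}^{=}=\{\mathbf{x}\in\mathbf{X}\mid\partial\mathbf{x}\text{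 not maximal in }P\}$: (1) $\{\mathbf y\in\mathbf X\mid\mathbf y\subseteq\mathbf x\}$ is $\mathrm{cf}(\lambda)$-small for each $\mathbf x\in\mathbf X^{=}$; (2) for each map $S\colon\mathbf{X}^{=}\to[X]^{<\lambda}$ there is an isotone $\sigma\colon P\to\mathbf{X}$ with $\partial\sigma(p)=p$ for all $p$ and $S(\sigma(a))\cap\sigma(b)\subseteq\sigma(a)$ for all $a<b$ in $P$; (3) if $\lambda=\aleph_0$ then $X$ is supported. **$P$-scaled Boolean algebras.** An object of $\mathbf{Bool}_P$ is $\mathbf{A}=(A,(A^{(p)}\mid p\in P))$ with $A$ a Boolean algebra, each $A^{(p)}$ an ideal of $A$, such that $A=\bigvee_{p}A^{(p)}$ and $A^{(p)}\cap A^{(q)}=\bigvee_{r\ge p,q}A^{(r)}$ for all $p,q$ (joins in the ideal lattice of $A$). A morphism $\mathbf{A}\to\mathbf{B}$ is a Boolean homomorphism $f$ with $f(A^{(p)})\subseteq B^{(p)}$ for all $p$. For an atom $a$ of $A$, $\{p\mid a\in A^{(p)}\}$ is an ideal of $P$; $|a|$ denotes its largest element if it exists. $\mathbf{A}$ is *compact* if $A$ is finite and $|a|$ exists for each atom $a$. Every object of $\mathbf{Bool}_P$ is a directed colimit of compact ones, and the compact objects are exactly the finitely presented ones. For $p\in P$, $\mathbf 2[p]$ is the compact object with underlying algebra $\{0,1\}$, with $\mathbf 2[p]^{(q)}=\{0,1\}$ if $q\le p$ and $\{0\}$ otherwise. **$\mathbf F(X)$ and $\pi^X_{\mathbf x}$.**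 For a norm-covering $X$ of $P$, $\mathrm F(X)$ is the Boolean algebra with generators $\tilde u$ ($u\in X$) and relations $\tilde v\le\tilde u$ for $u\le v$; $\tilde u\wedge\tilde v=\bigvee\{\tilde w\mid w\in u\mathbin{\nabla}v\}$; $1=\bigvee\{\tilde u\mid u\text{ minimal in }X\}$. $\mathrm F(X)^{(p)}$ is the ideal generated by $\{\tilde u\mid p\le\partial u\}$, and $\mathbf F(X)=(\mathrm F(X),(\mathrm F(X)^{(p)}\mid p\in P))\in\mathbf{Bool}_P$. For a sharp ideal $\mathbf x$ of $X$, $\pi^X_{\mathbf x}\colon\mathbf F(X)\to\mathbf 2[\partial\mathbf x]$ is the morphism in $\mathbf{Bool}_P$ sending $\tilde v$ to $1$ if $v\in\mathbf x$ and to $0$ otherwise. **Condensates.** Let $\mathcal A$ be a category with all small directed colimits and binary products, $\overrightarrow A$ a $P$-indexed diagram in $\mathcal A$. For compact $\mathbf A$, $\mathbf A\otimes\overrightarrow A=\prod(A_{|u|}\mid u\text{ atom of }A)$ (so $\mathbf 2[p]\otimes\overrightarrow A=A_p$); for a morphism $\varphi\colon\mathbf A\to\mathbf B$ of compact objects, $\varphi\otimes\overrightarrow A$ is the morphism whose component at an atom $v$ of $B$ is the projection to $A_{|u|}$ followed by $\alpha_{|u|}^{|v|}$, where $u$ is the unique atom of $A$ with $v\le\varphi(u)$. This functor extends, uniquely up to isomorphism, to a functor $-\otimes\overrightarrow A\colon\mathbf{Bool}_P\to\mathcal A$ preserving all small directed colimits. **Weakly presented objects.** An object $A$ of a category $\mathcal{C}$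 is *weakly $\lambda$-presented* if for every set $\Omega$ and every colimit $B=\varinjlim_{Z\in[\Omega]^{<\lambda}}B_Z$ in $\mathcal C$ of a continuous diagram (i.e., preserving all existing directed suprema of $[\Omega]^{<\lambda}$ as colimits), every morphism $A\to B$ factors through some limiting morphism $B_Z\to B$. *)

theory Defs
  imports Main "HOL-Library.FuncSet"
begin

unbundle cardinal_syntax

text \<open>
  Size convention. A type \<open>'u\<close> plays the role of the universe of small sets: small index posets,
  the sets \<open>\<Omega>\<close> and the underlying sets of Boolean algebras are sets with elements in \<open>'u\<close>.
  Notions that depend on this choice take an argument of type \<open>'u itself\<close>, or mention \<open>'u\<close> in
  their type. Carriers of categories are not restricted in size.
\<close>


section \<open>Cofinality\<close>

definition cf :: "'l rel \<Rightarrow> 'l rel" where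
  "cf r = |SOME K. K \<subseteq> Field r \<and> cofinal K r \<and>
             (\<forall>K'. K' \<subseteq> Field r \<and> cofinal K' r \<longrightarrow> |K| \<le>o |K'| )|"

definition small_subsets :: "'l rel \<Rightarrow> 'a set \<Rightarrow> 'a set set" where
  "small_subsets \<kappa> X = {Y. Y \<subseteq> X \<and> |Y| <o \<kappa>}"


section \<open>Posets\<close>

definition upper_bounds :: "'x::order set \<Rightarrow> 'x set" where
  "upper_bounds Y = {p. \<forall>y\<in>Y. y \<le> p}"

definition nabla :: "'x::order set \<Rightarrow> 'x set" where
  "nabla Y = {p \<in> upper_bounds Y. \<forall>q \<in> upper_bounds Y. q \<le> p \<longrightarrow> q = p}"

definition pseudo_join_semilattice :: "'x::order itself \<Rightarrow> bool" where
  "pseudo_join_semilattice _ \<longleftrightarrow>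
     (\<forall>Y::'x set. Y = {} \<or> card Y = 2 \<longrightarrow>
        (\<exists>F. finite F \<and> upper_bounds Y = {p. \<exists>f\<in>F. f \<le> p}))"

definition nabla_closed :: "'x::order set \<Rightarrow> bool" where
  "nabla_closed Z \<longleftrightarrow> (\<forall>Y. finite Y \<and> Y \<subseteq> Z \<longrightarrow> nabla Y \<subseteq> Z)"

definition nabla_closure :: "'x::order set \<Rightarrow> 'x set" where
  "nabla_closure Y = \<Inter>{Z. nabla_closed Z \<and> Y \<subseteq> Z}"

definition supported :: "'x::order itself \<Rightarrow> bool" where
  "supported _ \<longleftrightarrow> pseudo_join_semilattice TYPE('x) \<and>
     (\<forall>Y::'x set. finite Y \<longrightarrow> finite (nabla_closure Y))"

definition poset_ideal :: "'x::order set \<Rightarrow> bool" where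
  "poset_ideal I \<longleftrightarrow> I \<noteq> {} \<and> (\<forall>x\<in>I. \<forall>y\<in>I. \<exists>z\<in>I. x \<le> z \<and> y \<le> z) \<and>
     (\<forall>x\<in>I. \<forall>y. y \<le> x \<longrightarrow> y \<in> I)"

definition directed_poset :: "'i set \<Rightarrow> ('i \<Rightarrow> 'i \<Rightarrow> bool) \<Rightarrow> bool" where
  "directed_poset I le \<longleftrightarrow> I \<noteq> {} \<and>
     (\<forall>i\<in>I. le i i) \<and>
     (\<forall>i\<in>I. \<forall>j\<in>I. le i j \<and> le j i \<longrightarrow> i = j) \<and>
     (\<forall>i\<in>I. \<forall>j\<in>I. \<forall>k\<in>I. le i j \<and> le j k \<longrightarrow> le i k) \<and>
     (\<forall>i\<in>I. \<forall>j\<in>I. \<exists>k\<in>I. le i k \<and> le j k)"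

definition is_sup_in :: "'i set \<Rightarrow> ('i \<Rightarrow> 'i \<Rightarrow> bool) \<Rightarrow> 'i set \<Rightarrow> 'i \<Rightarrow> bool" where
  "is_sup_in I le J w \<longleftrightarrow> w \<in> I \<and> (\<forall>j\<in>J. le j w) \<and> (\<forall>v\<in>I. (\<forall>j\<in>J. le j v) \<longrightarrow> le w v)"


section \<open>Norm-coverings and lifters\<close>

definition norm_covering :: "('x::order \<Rightarrow> 'p::order) \<Rightarrow> bool" where
  "norm_covering d \<longleftrightarrow> pseudo_join_semilattice TYPE('x) \<and> mono d"

definition sharp_ideals :: "('x::order \<Rightarrow> 'p::order) \<Rightarrow> 'x set set" where
  "sharp_ideals d = {u. poset_ideal u \<and> (\<exists>m \<in> d ` u. \<forall>p \<in> d ` u. p \<le> m)}"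

definition ideal_norm :: "('x::order \<Rightarrow> 'p::order) \<Rightarrow> 'x set \<Rightarrow> 'p" where
  "ideal_norm d u = (GREATEST p. p \<in> d ` u)"

definition nonmax :: "('x::order \<Rightarrow> 'p::order) \<Rightarrow> 'x set set \<Rightarrow> 'x set set" where
  "nonmax d XX = {x \<in> XX. \<exists>q. ideal_norm d x < q}"

definition isotone_section :: "('x::order \<Rightarrow> 'p::order) \<Rightarrow> 'x set set \<Rightarrow> ('p \<Rightarrow> 'x set) \<Rightarrow> bool" where
  "isotone_section d XX \<sigma> \<longleftrightarrow> range \<sigma> \<subseteq> XX \<and> mono \<sigma> \<and> (\<forall>p. ideal_norm d (\<sigma> p) = p)"

definition lifter :: "'l rel \<Rightarrow> ('x::order \<Rightarrow> 'p::order) \<Rightarrow> 'x set set \<Rightarrow> bool" where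
  "lifter lam d XX \<longleftrightarrow>
     norm_covering d \<and> XX \<subseteq> sharp_ideals d \<and>
     (\<forall>x \<in> nonmax d XX. |{y \<in> XX. y \<subseteq> x}| <o cf lam) \<and>
     (\<forall>S. S ` nonmax d XX \<subseteq> small_subsets lam UNIV \<longrightarrow>
        (\<exists>\<sigma>. isotone_section d XX \<sigma> \<and> (\<forall>a b. a < b \<longrightarrow> S (\<sigma> a) \<inter> \<sigma> b \<subseteq> \<sigma> a))) \<and>
     (lam =o natLeq \<longrightarrow> supported TYPE('x))"


section \<open>Categories\<close>

record ('o, 'm) cat =
  Ob :: "'o set"
  Ar :: "'m set"
  src :: "'m \<Rightarrow> 'o"
  tgt :: "'m \<Rightarrow> 'o"
  ident :: "'o \<Rightarrow> 'm"
  cmp :: "'m \<Rightarrow> 'm \<Rightarrow> 'm"  (infixr \<open>\<cdot>\<index>\<close> 70)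

definition Hom :: "('o, 'm) cat \<Rightarrow> 'o \<Rightarrow> 'o \<Rightarrow> 'm set" where
  "Hom C a b = {f \<in> Ar C. src C f = a \<and> tgt C f = b}"

locale is_category =
  fixes C :: "('o, 'm) cat" (structure)
  assumes src_in: "f \<in> Ar C \<Longrightarrow> src C f \<in> Ob C"
    and tgt_in: "f \<in> Ar C \<Longrightarrow> tgt C f \<in> Ob C"
    and ident_in: "a \<in> Ob C \<Longrightarrow> ident C a \<in> Hom C a a"
    and cmp_in: "f \<in> Hom C a b \<Longrightarrow> g \<in> Hom C b c \<Longrightarrow> g \<cdot> f \<in> Hom C a c"
    and ident_right: "f \<in> Hom C a b \<Longrightarrow> f \<cdot> ident C a = f"
    and ident_left: "f \<in> Hom C a b \<Longrightarrow> ident C b \<cdot> f = f"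
    and cmp_assoc: "f \<in> Hom C a b \<Longrightarrow> g \<in> Hom C b c \<Longrightarrow> h \<in> Hom C c e \<Longrightarrow>
                      (h \<cdot> g) \<cdot> f = h \<cdot> (g \<cdot> f)"

record ('o1, 'm1, 'o2, 'm2) ftr =
  omap :: "'o1 \<Rightarrow> 'o2"
  amap :: "'m1 \<Rightarrow> 'm2"

definition is_functor ::
    "('o1, 'm1) cat \<Rightarrow> ('o2, 'm2) cat \<Rightarrow> ('o1, 'm1, 'o2, 'm2) ftr \<Rightarrow> bool" where
  "is_functor C D F \<longleftrightarrow>
     (\<forall>a \<in> Ob C. omap F a \<in> Ob D \<and> amap F (ident C a) = ident D (omap F a)) \<and>
     (\<forall>a b. \<forall>f \<in> Hom C a b. amap F f \<in> Hom D (omap F a) (omap F b)) \<and>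
     (\<forall>a b c. \<forall>f \<in> Hom C a b. \<forall>g \<in> Hom C b c.
        amap F (g \<cdot>\<^bsub>C\<^esub> f) = amap F g \<cdot>\<^bsub>D\<^esub> amap F f)"

definition slice :: "('o, 'm) cat \<Rightarrow> 'o \<Rightarrow> ('o \<times> 'm, ('o \<times> 'm) \<times> 'm \<times> ('o \<times> 'm)) cat" where
  "slice C s = \<lparr>
     Ob = {(a, f). f \<in> Hom C a s},
     Ar = {((a, f), h, (b, g)). f \<in> Hom C a s \<and> g \<in> Hom C b s \<and> h \<in> Hom C a b \<and> g \<cdot>\<^bsub>C\<^esub> h = f},
     src = fst,
     tgt = (\<lambda>m. snd (snd m)),
     ident = (\<lambda>(a, f). ((a, f), ident C a, (a, f))),
     cmp = (\<lambda>(_, k, z) (x, h, _). (x, k \<cdot>\<^bsub>C\<^esub> h, z)) \<rparr>"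

subsection \<open>Poset-indexed diagrams and their colimits\<close>

definition diagram :: "('o, 'm) cat \<Rightarrow> 'i set \<Rightarrow> ('i \<Rightarrow> 'i \<Rightarrow> bool) \<Rightarrow>
    ('i \<Rightarrow> 'o) \<Rightarrow> ('i \<Rightarrow> 'i \<Rightarrow> 'm) \<Rightarrow> bool" where
  "diagram C I le D d \<longleftrightarrow>
     (\<forall>i\<in>I. D i \<in> Ob C \<and> d i i = ident C (D i)) \<and>
     (\<forall>i\<in>I. \<forall>j\<in>I. le i j \<longrightarrow> d i j \<in> Hom C (D i) (D j)) \<and>
     (\<forall>i\<in>I. \<forall>j\<in>I. \<forall>k\<in>I. le i j \<and> le j k \<longrightarrow> d i k = d j k \<cdot>\<^bsub>C\<^esub> d i j)"

definition nat_trans :: "('o, 'm) cat \<Rightarrow> 'i set \<Rightarrow> ('i \<Rightarrow> 'i \<Rightarrow> bool) \<Rightarrow>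
    ('i \<Rightarrow> 'o) \<Rightarrow> ('i \<Rightarrow> 'i \<Rightarrow> 'm) \<Rightarrow> ('i \<Rightarrow> 'o) \<Rightarrow> ('i \<Rightarrow> 'i \<Rightarrow> 'm) \<Rightarrow> ('i \<Rightarrow> 'm) \<Rightarrow> bool" where
  "nat_trans C I le D d E e \<eta> \<longleftrightarrow>
     diagram C I le D d \<and> diagram C I le E e \<and>
     (\<forall>i\<in>I. \<eta> i \<in> Hom C (D i) (E i)) \<and>
     (\<forall>i\<in>I. \<forall>j\<in>I. le i j \<longrightarrow> \<eta> j \<cdot>\<^bsub>C\<^esub> d i j = e i j \<cdot>\<^bsub>C\<^esub> \<eta> i)"

definition cocone :: "('o, 'm) cat \<Rightarrow> 'i set \<Rightarrow> ('i \<Rightarrow> 'i \<Rightarrow> bool) \<Rightarrow>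
    ('i \<Rightarrow> 'o) \<Rightarrow> ('i \<Rightarrow> 'i \<Rightarrow> 'm) \<Rightarrow> 'o \<Rightarrow> ('i \<Rightarrow> 'm) \<Rightarrow> bool" where
  "cocone C I le D d L l \<longleftrightarrow> L \<in> Ob C \<and> (\<forall>i\<in>I. l i \<in> Hom C (D i) L) \<and>
     (\<forall>i\<in>I. \<forall>j\<in>I. le i j \<longrightarrow> l j \<cdot>\<^bsub>C\<^esub> d i j = l i)"

definition colimit :: "('o, 'm) cat \<Rightarrow> 'i set \<Rightarrow> ('i \<Rightarrow> 'i \<Rightarrow> bool) \<Rightarrow>
    ('i \<Rightarrow> 'o) \<Rightarrow> ('i \<Rightarrow> 'i \<Rightarrow> 'm) \<Rightarrow> 'o \<Rightarrow> ('i \<Rightarrow> 'm) \<Rightarrow> bool" where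
  "colimit C I le D d L l \<longleftrightarrow> cocone C I le D d L l \<and>
     (\<forall>M m. cocone C I le D d M m \<longrightarrow>
        (\<exists>!h. h \<in> Hom C L M \<and> (\<forall>i\<in>I. h \<cdot>\<^bsub>C\<^esub> l i = m i)))"

definition has_directed_colimits :: "'u itself \<Rightarrow> ('o, 'm) cat \<Rightarrow> bool" where
  "has_directed_colimits _ C \<longleftrightarrow>
     (\<forall>(I::'u set) le D d. directed_poset I le \<and> diagram C I le D d \<longrightarrow>
        (\<exists>L l. colimit C I le D d L l))"

definition preserves_directed_colimits ::
    "'u itself \<Rightarrow> ('o1, 'm1) cat \<Rightarrow> ('o2, 'm2) cat \<Rightarrow> ('o1, 'm1, 'o2, 'm2) ftr \<Rightarrow> bool" where
  "preserves_directed_colimits _ C D F \<longleftrightarrow>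
     (\<forall>(I::'u set) le E e L l.
        directed_poset I le \<and> diagram C I le E e \<and> colimit C I le E e L l \<longrightarrow>
        colimit D I le (\<lambda>i. omap F (E i)) (\<lambda>i j. amap F (e i j)) (omap F L) (\<lambda>i. amap F (l i)))"

definition continuous_diagram :: "('o, 'm) cat \<Rightarrow> 'i set \<Rightarrow> ('i \<Rightarrow> 'i \<Rightarrow> bool) \<Rightarrow>
    ('i \<Rightarrow> 'o) \<Rightarrow> ('i \<Rightarrow> 'i \<Rightarrow> 'm) \<Rightarrow> bool" where
  "continuous_diagram C I le D d \<longleftrightarrow> diagram C I le D d \<and>
     (\<forall>J w. J \<subseteq> I \<and> directed_poset J le \<and> is_sup_in I le J w \<longrightarrow>
        colimit C J le D d (D w) (\<lambda>j. d j w))"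

definition weakly_presented :: "'u itself \<Rightarrow> 'l rel \<Rightarrow> ('o, 'm) cat \<Rightarrow> 'o \<Rightarrow> bool" where
  "weakly_presented _ lam C a \<longleftrightarrow> a \<in> Ob C \<and>
     (\<forall>(\<Omega>::'u set) D d L l.
        continuous_diagram C (small_subsets lam \<Omega>) (\<subseteq>) D d \<and>
        colimit C (small_subsets lam \<Omega>) (\<subseteq>) D d L l \<longrightarrow>
        (\<forall>f \<in> Hom C a L. \<exists>Z \<in> small_subsets lam \<Omega>. \<exists>g \<in> Hom C a (D Z). f = l Z \<cdot>\<^bsub>C\<^esub> g))"

subsection \<open>Products\<close>

definition is_product ::
    "('o, 'm) cat \<Rightarrow> 'j set \<Rightarrow> ('j \<Rightarrow> 'o) \<Rightarrow> 'o \<Rightarrow> ('j \<Rightarrow> 'm) \<Rightarrow> bool" where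
  "is_product C J D L pr \<longleftrightarrow> L \<in> Ob C \<and> (\<forall>j\<in>J. pr j \<in> Hom C L (D j)) \<and>
     (\<forall>M \<in> Ob C. \<forall>m. (\<forall>j\<in>J. m j \<in> Hom C M (D j)) \<longrightarrow>
        (\<exists>!h. h \<in> Hom C M L \<and> (\<forall>j\<in>J. pr j \<cdot>\<^bsub>C\<^esub> h = m j)))"

definition has_binary_products :: "('o, 'm) cat \<Rightarrow> bool" where
  "has_binary_products C \<longleftrightarrow>
     (\<forall>a \<in> Ob C. \<forall>b \<in> Ob C. \<exists>L pr. is_product C (UNIV::bool set) (\<lambda>j. if j then a else b) L pr)"


section \<open>Boolean algebras with explicit carrier\<close>

record 'u balg =
  carr :: "'u set"
  meet :: "'u \<Rightarrow> 'u \<Rightarrow> 'u"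
  join :: "'u \<Rightarrow> 'u \<Rightarrow> 'u"
  neg :: "'u \<Rightarrow> 'u"
  bzero :: 'u
  bone :: 'u

text \<open>The axioms of \<^locale>\<open>abstract_boolean_algebra\<close>, relativised to the carrier.\<close>

locale boolean_alg =
  fixes A :: "('u, 'z) balg_scheme"
  assumes meet_in: "x \<in> carr A \<Longrightarrow> y \<in> carr A \<Longrightarrow> meet A x y \<in> carr A"
    and join_in: "x \<in> carr A \<Longrightarrow> y \<in> carr A \<Longrightarrow> join A x y \<in> carr A"
    and neg_in: "x \<in> carr A \<Longrightarrow> neg A x \<in> carr A"
    and zero_in: "bzero A \<in> carr A"
    and one_in: "bone A \<in> carr A"
    and meet_comm: "x \<in> carr A \<Longrightarrow> y \<in> carr A \<Longrightarrow> meet A x y = meet A y x"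
    and join_comm: "x \<in> carr A \<Longrightarrow> y \<in> carr A \<Longrightarrow> join A x y = join A y x"
    and meet_assoc: "x \<in> carr A \<Longrightarrow> y \<in> carr A \<Longrightarrow> z \<in> carr A \<Longrightarrow>
                       meet A (meet A x y) z = meet A x (meet A y z)"
    and join_assoc: "x \<in> carr A \<Longrightarrow> y \<in> carr A \<Longrightarrow> z \<in> carr A \<Longrightarrow>
                       join A (join A x y) z = join A x (join A y z)"
    and meet_join_distrib: "x \<in> carr A \<Longrightarrow> y \<in> carr A \<Longrightarrow> z \<in> carr A \<Longrightarrow>
                       meet A x (join A y z) = join A (meet A x y) (meet A x z)"
    and join_meet_distrib: "x \<in> carr A \<Longrightarrow> y \<in> carr A \<Longrightarrow> z \<in> carr A \<Longrightarrow>
                       join A x (meet A y z) = meet A (join A x y) (join A x z)"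
    and meet_one: "x \<in> carr A \<Longrightarrow> meet A x (bone A) = x"
    and join_zero: "x \<in> carr A \<Longrightarrow> join A x (bzero A) = x"
    and meet_neg: "x \<in> carr A \<Longrightarrow> meet A x (neg A x) = bzero A"
    and join_neg: "x \<in> carr A \<Longrightarrow> join A x (neg A x) = bone A"

definition ble :: "('u, 'z) balg_scheme \<Rightarrow> 'u \<Rightarrow> 'u \<Rightarrow> bool" where
  "ble A x y \<longleftrightarrow> meet A x y = x"

definition is_join :: "('u, 'z) balg_scheme \<Rightarrow> 'u set \<Rightarrow> 'u \<Rightarrow> bool" where
  "is_join A S z \<longleftrightarrow> is_sup_in (carr A) (ble A) S z"

definition atoms :: "('u, 'z) balg_scheme \<Rightarrow> 'u set" where
  "atoms A = {a \<in> carr A. a \<noteq> bzero A \<and> (\<forall>b \<in> carr A. ble A b a \<longrightarrow> b = bzero A \<or> b = a)}"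

definition balg_ideal :: "('u, 'z) balg_scheme \<Rightarrow> 'u set \<Rightarrow> bool" where
  "balg_ideal A I \<longleftrightarrow> I \<subseteq> carr A \<and> bzero A \<in> I \<and> (\<forall>x\<in>I. \<forall>y\<in>I. join A x y \<in> I) \<and>
     (\<forall>x\<in>I. \<forall>y \<in> carr A. ble A y x \<longrightarrow> y \<in> I)"

definition ideal_gen :: "('u, 'z) balg_scheme \<Rightarrow> 'u set \<Rightarrow> 'u set" where
  "ideal_gen A S = \<Inter>{I. balg_ideal A I \<and> S \<subseteq> I}"

text \<open>Homomorphisms are made extensional so that equality of homomorphisms is equality on the carrier.\<close>

definition bhom :: "('u, 'y) balg_scheme \<Rightarrow> ('v, 'z) balg_scheme \<Rightarrow> ('u \<Rightarrow> 'v) set" where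
  "bhom A B = {f \<in> carr A \<rightarrow>\<^sub>E carr B.
     (\<forall>x \<in> carr A. \<forall>y \<in> carr A. f (meet A x y) = meet B (f x) (f y) \<and>
                                f (join A x y) = join B (f x) (f y)) \<and>
     (\<forall>x \<in> carr A. f (neg A x) = neg B (f x)) \<and>
     f (bzero A) = bzero B \<and> f (bone A) = bone B}"


section \<open>Scaled Boolean algebras\<close>

record ('u, 'p) scaled = "'u balg" +
  scale :: "'p \<Rightarrow> 'u set"

text \<open>
  The one-element Boolean algebra is excluded: it has no atoms, so the condensate at it would be a
  terminal object, which a category with binary products need not have.
\<close>

definition scaled_boolean_algebra :: "('u, 'p::order) scaled \<Rightarrow> bool" where
  "scaled_boolean_algebra A \<longleftrightarrow>
     boolean_alg A \<and> bzero A \<noteq> bone A \<and>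
     (\<forall>p. balg_ideal A (scale A p)) \<and>
     carr A = ideal_gen A (\<Union>p. scale A p) \<and>
     (\<forall>p q. scale A p \<inter> scale A q = ideal_gen A (\<Union>r \<in> {r. p \<le> r \<and> q \<le> r}. scale A r))"

type_synonym ('u, 'p) scaled_arrow = "('u, 'p) scaled \<times> ('u \<Rightarrow> 'u) \<times> ('u, 'p) scaled"

definition BoolP :: "(('u, 'p::order) scaled, ('u, 'p) scaled_arrow) cat" where
  "BoolP = \<lparr>
     Ob = {A. scaled_boolean_algebra A},
     Ar = {(A, f, B). scaled_boolean_algebra A \<and> scaled_boolean_algebra B \<and> f \<in> bhom A B \<and>
                      (\<forall>p. f ` scale A p \<subseteq> scale B p)},
     src = fst,
     tgt = (\<lambda>m. snd (snd m)),
     ident = (\<lambda>A. (A, (\<lambda>x \<in> carr A. x), A)),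
     cmp = (\<lambda>(_, g, Z) (X, f, _). (X, compose (carr X) g f, Z)) \<rparr>"

definition arrow_fun :: "('u, 'p) scaled_arrow \<Rightarrow> 'u \<Rightarrow> 'u" where
  "arrow_fun m = fst (snd m)"

definition has_norm :: "('u, 'p::order) scaled \<Rightarrow> 'u \<Rightarrow> bool" where
  "has_norm A a \<longleftrightarrow> (\<exists>p. a \<in> scale A p \<and> (\<forall>q. a \<in> scale A q \<longrightarrow> q \<le> p))"

definition atom_norm :: "('u, 'p::order) scaled \<Rightarrow> 'u \<Rightarrow> 'p" where
  "atom_norm A a = (GREATEST p. a \<in> scale A p)"

definition compact_scaled :: "('u, 'p::order) scaled \<Rightarrow> bool" where
  "compact_scaled A \<longleftrightarrow> scaled_boolean_algebra A \<and> finite (carr A) \<and> (\<forall>a \<in> atoms A. has_norm A a)"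

text \<open>The class constraint on \<open>'u\<close> only serves to name two distinct elements of \<open>'u\<close>.\<close>

definition two :: "'p::order \<Rightarrow> ('u::zero_neq_one, 'p) scaled" where
  "two p = \<lparr>
     carr = {0, 1},
     meet = (\<lambda>x y. if x = 1 \<and> y = 1 then 1 else 0),
     join = (\<lambda>x y. if x = 1 \<or> y = 1 then 1 else 0),
     neg = (\<lambda>x. if x = 1 then 0 else 1),
     bzero = 0,
     bone = 1,
     scale = (\<lambda>q. if q \<le> p then {0, 1} else {0}) \<rparr>"


section \<open>The scaled Boolean algebra of a norm-covering\<close>

definition F_relations :: "('u, 'z) balg_scheme \<Rightarrow> ('x::order \<Rightarrow> 'u) \<Rightarrow> bool" where
  "F_relations B g \<longleftrightarrow>
     range g \<subseteq> carr B \<and>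
     (\<forall>u v. u \<le> v \<longrightarrow> ble B (g v) (g u)) \<and>
     (\<forall>u v. is_join B (g ` nabla {u, v}) (meet B (g u) (g v))) \<and>
     is_join B (g ` {u. \<forall>v. v \<le> u \<longrightarrow> v = u}) (bone B)"

text \<open>
  \<open>A\<close> is the Boolean algebra presented by the generators \<open>gen u\<close> subject to the relations above
  (expressed by its universal property), with the ideals generated by the prescribed generators.
\<close>

definition is_F :: "('x::order \<Rightarrow> 'p::order) \<Rightarrow> ('u, 'p) scaled \<Rightarrow> ('x \<Rightarrow> 'u) \<Rightarrow> bool" where
  "is_F d A gen \<longleftrightarrow>
     boolean_alg A \<and> F_relations A gen \<and>
     (\<forall>(B::'u balg) g. boolean_alg B \<and> F_relations B g \<longrightarrow>
        (\<exists>!h. h \<in> bhom A B \<and> (\<forall>u. h (gen u) = g u))) \<and>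
     (\<forall>p. scale A p = ideal_gen A {gen u | u. p \<le> d u})"

definition pi_arrow :: "('x::order \<Rightarrow> 'p::order) \<Rightarrow> ('u::zero_neq_one, 'p) scaled \<Rightarrow> ('x \<Rightarrow> 'u) \<Rightarrow>
    'x set \<Rightarrow> ('u, 'p) scaled_arrow" where
  "pi_arrow d A gen x =
     (THE m. m \<in> Hom BoolP A (two (ideal_norm d x)) \<and>
             (\<forall>v. arrow_fun m (gen v) = (if v \<in> x then 1 else 0)))"


section \<open>Condensates\<close>

text \<open>
  \<open>T\<close> is a functor \<open>- \<otimes> (A, \<alpha>)\<close>, and \<open>pr B u : T B \<rightarrow> A\<^bsub>|u|\<^esub>\<close> are the projections of the product
  \<open>T B\<close>, for compact \<open>B\<close> and atoms \<open>u\<close> of \<open>B\<close>. In particular \<open>pr (two p) 1\<close> is the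
  canonical isomorphism \<open>two p \<otimes> (A, \<alpha>) \<cong> A p\<close>.
\<close>

definition is_condensate :: "('o, 'm) cat \<Rightarrow> ('p::order \<Rightarrow> 'o) \<Rightarrow> ('p \<Rightarrow> 'p \<Rightarrow> 'm) \<Rightarrow>
    (('u, 'p) scaled, ('u, 'p) scaled_arrow, 'o, 'm) ftr \<Rightarrow>
    (('u, 'p) scaled \<Rightarrow> 'u \<Rightarrow> 'm) \<Rightarrow> bool" where
  "is_condensate C A \<alpha> T pr \<longleftrightarrow>
     is_functor BoolP C T \<and>
     preserves_directed_colimits TYPE('u) BoolP C T \<and>
     (\<forall>B. compact_scaled B \<longrightarrow>
        is_product C (atoms B) (\<lambda>u. A (atom_norm B u)) (omap T B) (pr B)) \<and>
     (\<forall>B B'. compact_scaled B \<and> compact_scaled B' \<longrightarrow>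
        (\<forall>\<phi> \<in> Hom BoolP B B'. \<forall>v \<in> atoms B'. \<forall>u \<in> atoms B. ble B' v (arrow_fun \<phi> u) \<longrightarrow>
           pr B' v \<cdot>\<^bsub>C\<^esub> amap T \<phi> = \<alpha> (atom_norm B u) (atom_norm B' v) \<cdot>\<^bsub>C\<^esub> pr B u))"

end

theory Submission
  imports Defs
begin

text \<open>
  For a \<open>\<nabla>\<close>-closed set \<open>Z \<subseteq> X\<close>, let \<open>F(Z)\<close> be the subalgebra of \<open>F(X)\<close> generated by the
  generators attached to \<open>u \<in> Z\<close>. Since every directed union of such subalgebras is a directed colimit in
  \<open>Bool\<^sub>P\<close>, and since the \<open>\<nabla>\<close>-closure of a \<open>\<lambda>\<close>-small set is \<open>\<lambda>\<close>-small, \<open>\<Phi>(F(X) \<otimes> A)\<close> is the colimit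
  of a continuous diagram indexed by the \<open>\<lambda>\<close>-small subsets of \<open>X\<close>. Hence for each nonmaximal \<open>x\<close>, the
  morphism \<open>\<chi> \<circ> \<phi>\<^sub>x\<close> factors through \<open>\<Phi>(F(V) \<otimes> A)\<close> for some \<open>\<lambda>\<close>-small \<open>\<nabla>\<close>-closed \<open>V = V(x)\<close>. The lifter
  supplies a section \<open>\<sigma>\<close> with \<open>V(\<sigma>(p)) \<inter> \<sigma>(q) \<subseteq> \<sigma>(p)\<close> for \<open>p < q\<close>. So \<open>\<sigma>(p)\<close> and \<open>\<sigma>(q)\<close> have the same trace
  on \<open>V(\<sigma>(p))\<close>, which means that \<open>\<pi>\<^bsub>\<sigma>(q)\<^esub>\<close> and \<open>\<pi>\<^bsub>\<sigma>(p)\<^esub>\<close>, the latter followed by \<open>2[p] \<rightarrow> 2[q]\<close>, agree on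
  \<open>F(V(\<sigma>(p)))\<close>. This is the required naturality.
\<close>

section \<open>Minimal upper bounds\<close>

text \<open>Adjoining \<open>y\<close> intersects a finite union of principal up-sets with the
  up-set of \<open>y\<close>, and the up-set of \<open>f\<close> meets that of \<open>y\<close> in
  \<open>upper_bounds {f, y}\<close>. The axiom speaks of exactly two elements, so
  \<open>f = y\<close> is a separate case.\<close>

lemma upper_bounds_finitely_generated:
  fixes Y :: "'x::order set"
  assumes "pseudo_join_semilattice TYPE('x)" "finite Y"
  shows "\<exists>F. finite F \<and> upper_bounds Y = {p. \<exists>f\<in>F. f \<le> p}"
  using assms(2)
proof induction
  case empty
  then show ?case using assms(1) unfolding pseudo_join_semilattice_def by blast
next
  case (insert y Y)
  then obtain F where F: "finite F" "upper_bounds Y = {p. \<exists>f\<in>F. f \<le> p}" by blast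
  have "\<exists>G. finite G \<and> upper_bounds {f, y} = {p. \<exists>g\<in>G. g \<le> p}" for f
  proof (cases "f = y")
    case True
    then show ?thesis by (intro exI[of _ "{y}"]) (auto simp: upper_bounds_def)
  next
    case False
    then have "card {f, y} = 2" by simp
    then show ?thesis using assms(1) unfolding pseudo_join_semilattice_def by blast
  qed
  then obtain G where G: "\<And>f. finite (G f)" "\<And>f. upper_bounds {f, y} = {p. \<exists>g\<in>G f. g \<le> p}"
    by metis
  have "upper_bounds (insert y Y) = upper_bounds Y \<inter> {p. y \<le> p}"
    by (auto simp: upper_bounds_def)
  also have "\<dots> = (\<Union>f\<in>F. upper_bounds {f, y})"
    unfolding F(2) by (auto simp: upper_bounds_def)
  also have "\<dots> = {p. \<exists>g\<in>(\<Union>f\<in>F. G f). g \<le> p}" unfolding G(2) by blast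
  finally show ?case using F(1) G(1) by (intro exI[of _ "\<Union>f\<in>F. G f"]) simp
qed

lemma finite_nabla:
  fixes Y :: "'x::order set"
  assumes "pseudo_join_semilattice TYPE('x)" "finite Y"
  shows "finite (nabla Y)"
proof -
  obtain F where F: "finite F" "upper_bounds Y = {p. \<exists>f\<in>F. f \<le> p}"
    using upper_bounds_finitely_generated[OF assms] by blast
  have "nabla Y \<subseteq> F" unfolding nabla_def F(2) by blast
  then show ?thesis using F(1) finite_subset by blast
qed

text \<open>Finiteness of \<open>F\<close> yields a minimal generator below \<open>p\<close>. It is
  minimal among all upper bounds, because every upper bound lies above some generator.\<close>

lemma nabla_below_upper_bound:
  fixes Y :: "'x::order set"
  assumes "pseudo_join_semilattice TYPE('x)" "finite Y" "p \<in> upper_bounds Y"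
  obtains q where "q \<in> nabla Y" "q \<le> p"
proof -
  obtain F where F: "finite F" "upper_bounds Y = {p. \<exists>f\<in>F. f \<le> p}"
    using upper_bounds_finitely_generated[OF assms(1,2)] by blast
  have "finite {f\<in>F. f \<le> p}" "{f\<in>F. f \<le> p} \<noteq> {}" using F assms(3) by auto
  from finite_has_minimal[OF this]
  obtain f where f: "f \<in> F" "f \<le> p" and "\<forall>g\<in>{f\<in>F. f \<le> p}. g \<le> f \<longrightarrow> f = g"
    by blast
  then have min: "f = g" if "g \<in> F" "g \<le> p" "g \<le> f" for g using that by simp
  have "q = f" if q: "q \<in> upper_bounds Y" "q \<le> f" for q
  proof -
    obtain g where g: "g \<in> F" "g \<le> q" using q(1) F(2) by blast
    then have "f = g" using min[OF g(1)] q(2) f(2) by (meson order.trans)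
    with g q show ?thesis by (simp add: order.antisym)
  qed
  then have "f \<in> nabla Y" using f F(2) by (auto simp: nabla_def)
  with f(2) that show thesis by blast
qed

lemma nabla_upper: "w \<in> nabla Y \<Longrightarrow> y \<in> Y \<Longrightarrow> y \<le> w"
  by (auto simp: nabla_def upper_bounds_def)

text \<open>Identifies the index set of the join giving the unit in \<open>F_relations\<close> with
  a value of \<open>nabla\<close>, so every nabla-closed set contains it.\<close>

lemma nabla_empty: "nabla {} = {u. \<forall>v. v \<le> u \<longrightarrow> v = u}"
  by (auto simp: nabla_def upper_bounds_def)

text \<open>For \<open>w\<close> minimal above \<open>insert y Y\<close>, there is \<open>f\<close>
  in \<open>nabla Y\<close> below \<open>w\<close>, and then \<open>g\<close> in
  \<open>nabla {f, y}\<close> below \<open>w\<close>. This \<open>g\<close> is an upper bound of the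
  whole set, so minimality gives \<open>g = w\<close>: every \<open>w\<close> arises from a
  pair.\<close>

lemma nabla_closedI:
  fixes Z :: "'x::order set"
  assumes pjs: "pseudo_join_semilattice TYPE('x)"
    and empty: "nabla {} \<subseteq> Z" and pair: "\<And>u v. u \<in> Z \<Longrightarrow> v \<in> Z \<Longrightarrow> nabla {u, v} \<subseteq> Z"
  shows "nabla_closed Z"
proof -
  have "nabla Y \<subseteq> Z" if "finite Y" "Y \<subseteq> Z" for Y
    using that
  proof induction
    case empty
    then show ?case using assms(2) by simp
  next
    case (insert y Y)
    show ?case
    proof
      fix w assume w: "w \<in> nabla (insert y Y)"
      then have "w \<in> upper_bounds Y" by (auto simp: nabla_def upper_bounds_def)
      then obtain f where f: "f \<in> nabla Y" "f \<le> w"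
        using nabla_below_upper_bound[OF pjs insert.hyps(1)] by blast
      have "w \<in> upper_bounds {f, y}"
        using w f(2) by (auto simp: nabla_def upper_bounds_def)
      then obtain g where g: "g \<in> nabla {f, y}" "g \<le> w"
        using nabla_below_upper_bound[OF pjs, of "{f, y}"] by blast
      have "g \<in> upper_bounds (insert y Y)"
        using f(1) g(1) by (force simp: nabla_def upper_bounds_def)
      then have "g = w" using w g(2) by (auto simp: nabla_def)
      then show "w \<in> Z" using pair[of f y] f(1) g(1) insert by blast
    qed
  qed
  then show ?thesis by (auto simp: nabla_closed_def)
qed

lemma nabla_closed_closure: "nabla_closed (nabla_closure Y)"
  unfolding nabla_closed_def nabla_closure_def by (safe, blast)

lemma subset_nabla_closure: "Y \<subseteq> nabla_closure Y"
  by (auto simp: nabla_closure_def)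

lemma nabla_closure_least: "nabla_closed Z \<Longrightarrow> Y \<subseteq> Z \<Longrightarrow> nabla_closure Y \<subseteq> Z"
  by (auto simp: nabla_closure_def)

lemma nabla_closure_mono: "Y \<subseteq> Z \<Longrightarrow> nabla_closure Y \<subseteq> nabla_closure Z"
  by (auto simp: nabla_closure_def)

section \<open>Directed unions of nabla-closed sets\<close>

lemma directed_poset_trans:
  "directed_poset I le \<Longrightarrow> i \<in> I \<Longrightarrow> j \<in> I \<Longrightarrow> k \<in> I \<Longrightarrow> le i j \<Longrightarrow> le j k \<Longrightarrow> le i k"
  unfolding directed_poset_def by metis

lemma directed_poset_bound:
  assumes "directed_poset I le" "i \<in> I" "j \<in> I"
  obtains k where "k \<in> I" "le i k" "le j k"
  using assms unfolding directed_poset_def by metis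

lemma directed_poset_finite_bound:
  assumes dir: "directed_poset I le" and "finite J" "J \<subseteq> I"
  shows "\<exists>k\<in>I. \<forall>j\<in>J. le j k"
  using assms(2,3)
proof induction
  case empty
  then show ?case using dir by (simp add: directed_poset_def ex_in_conv)
next
  case (insert j J)
  then obtain k where k: "k \<in> I" "\<forall>j\<in>J. le j k" by auto
  obtain k' where k': "k' \<in> I" "le k k'" "le j k'"
    using directed_poset_bound[OF dir k(1), of j] insert.prems by auto
  have "le i k'" if "i \<in> J" for i
    using directed_poset_trans[OF dir, of i k k'] k k' that insert.prems by auto
  then show ?case using k' by auto
qed

text \<open>Closedness is tested on finite sets, and a finite subset of a directed union lies in a
  single member.\<close>

lemma nabla_closed_directed_Union:
  assumes dir: "directed_poset I le" and cl: "\<And>i. i \<in> I \<Longrightarrow> nabla_closed (K i)"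
    and mono: "\<And>i j. i \<in> I \<Longrightarrow> j \<in> I \<Longrightarrow> le i j \<Longrightarrow> K i \<subseteq> K j"
  shows "nabla_closed (\<Union>i\<in>I. K i)"
  unfolding nabla_closed_def
proof (intro allI impI, elim conjE)
  fix Y assume Y: "finite Y" "Y \<subseteq> (\<Union>i\<in>I. K i)"
  then obtain f where f: "\<And>y. y \<in> Y \<Longrightarrow> f y \<in> I \<and> y \<in> K (f y)" by (metis UN_E subset_eq)
  then obtain k where k: "k \<in> I" "\<forall>j\<in>f ` Y. le j k"
    using directed_poset_finite_bound[OF dir, of "f ` Y"] Y(1) by blast
  have "Y \<subseteq> K k" using f k mono by blast
  then show "nabla Y \<subseteq> (\<Union>i\<in>I. K i)" using cl[OF k(1)] k(1) Y(1) by (auto simp: nabla_closed_def)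
qed

text \<open>The closure is finitary, hence compatible with directed unions. This later makes the
  diagram of small subalgebras continuous.\<close>

lemma nabla_closure_directed_Union:
  assumes dir: "directed_poset I le"
    and mono: "\<And>i j. i \<in> I \<Longrightarrow> j \<in> I \<Longrightarrow> le i j \<Longrightarrow> K i \<subseteq> K j"
  shows "nabla_closure (\<Union>i\<in>I. K i) = (\<Union>i\<in>I. nabla_closure (K i))"
proof
  show "nabla_closure (\<Union>i\<in>I. K i) \<subseteq> (\<Union>i\<in>I. nabla_closure (K i))"
    using mono by (intro nabla_closure_least nabla_closed_directed_Union[OF dir] nabla_closed_closure
        nabla_closure_mono UN_mono subset_nabla_closure order_refl)
  show "(\<Union>i\<in>I. nabla_closure (K i)) \<subseteq> nabla_closure (\<Union>i\<in>I. K i)"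
    by (intro UN_least nabla_closure_mono UN_upper)
qed

section \<open>Cardinality of nabla-closures\<close>

primrec nabla_iter :: "'x::order set \<Rightarrow> nat \<Rightarrow> 'x set" where
  "nabla_iter Y 0 = Y \<union> nabla {}"
| "nabla_iter Y (Suc n) =
     nabla_iter Y n \<union> (\<Union>u \<in> nabla_iter Y n. \<Union>v \<in> nabla_iter Y n. nabla {u, v})"

lemma nabla_iter_mono: "m \<le> n \<Longrightarrow> nabla_iter Y m \<subseteq> nabla_iter Y n"
  by (induction rule: inc_induct) auto

text \<open>The union of the stages is closed by \<open>nabla_closedI\<close>, since elements found
  at stages \<open>m\<close> and \<open>n\<close> both occur at stage
  \<open>max m n\<close>.\<close>

lemma nabla_closure_subset_iter:
  fixes Y :: "'x::order set"
  assumes "pseudo_join_semilattice TYPE('x)"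
  shows "nabla_closure Y \<subseteq> (\<Union>n. nabla_iter Y n)"
proof (intro nabla_closure_least nabla_closedI[OF assms])
  show "nabla {} \<subseteq> (\<Union>n. nabla_iter Y n)" "Y \<subseteq> (\<Union>n. nabla_iter Y n)"
    by (force intro: exI[of _ 0])+
  fix u v assume "u \<in> (\<Union>n. nabla_iter Y n)" "v \<in> (\<Union>n. nabla_iter Y n)"
  then obtain m n where "u \<in> nabla_iter Y m" "v \<in> nabla_iter Y n" by blast
  then have "u \<in> nabla_iter Y (max m n)" "v \<in> nabla_iter Y (max m n)"
    using nabla_iter_mono[of m "max m n" Y] nabla_iter_mono[of n "max m n" Y] by auto
  then have "nabla {u, v} \<subseteq> nabla_iter Y (Suc (max m n))" by auto
  then show "nabla {u, v} \<subseteq> (\<Union>n. nabla_iter Y n)" by blast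
qed

lemma finite_ordLess_Card_order:
  assumes "Card_order r" "infinite (Field r)" "finite A"
  shows "|A| <o r"
proof -
  have "natLeq \<le>o r" using assms natLeq_ordLeq_cinfinite by (auto simp: cinfinite_def)
  then show ?thesis using assms(3) ordLess_ordLeq_trans by (auto simp: finite_iff_ordLess_natLeq)
qed

lemma finite_ordLeq_infinite:
  assumes "infinite B" "finite A"
  shows "|A| \<le>o |B|"
  using assms finite_ordLess_Card_order[of "|B|" A]
  by (simp add: ordLess_imp_ordLeq Field_card_of card_of_card_order_on)

text \<open>Each stage adds a finite set for every pair from the preceding stage, and an infinite
  cardinal absorbs such unions.\<close>

lemma card_of_nabla_iter:
  fixes Y :: "'x::order set"
  assumes pjs: "pseudo_join_semilattice TYPE('x)" and B: "infinite B" and Y: "|Y| \<le>o |B|"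
  shows "|nabla_iter Y n| \<le>o |B|"
proof -
  have Un: "|C \<union> D| \<le>o |B|" if "|C| \<le>o |B|" "|D| \<le>o |B|" for C D :: "'x set"
    using card_of_Un_ordLeq_infinite_Field[OF _ that card_of_Card_order] B by (metis Field_card_of)
  show ?thesis
  proof (induction n)
    case 0
    have "finite (nabla {} :: 'x set)" using finite_nabla[OF pjs, of "{}"] by simp
    then have "|nabla {} :: 'x set| \<le>o |B|" using B by (simp add: finite_ordLeq_infinite)
    then show ?case using Un[OF Y] by simp
  next
    case (Suc n)
    have "|nabla {u, v}| \<le>o |B|" for u v :: 'x
      using finite_nabla[OF pjs, of "{u, v}"] B by (simp add: finite_ordLeq_infinite)
    then have "|\<Union>u \<in> nabla_iter Y n. \<Union>v \<in> nabla_iter Y n. nabla {u, v}| \<le>o |B|"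
      using Suc by (intro card_of_UNION_ordLeq_infinite[OF B] ballI)
    then show ?case using Un[OF Suc] by simp
  qed
qed

lemma card_of_nabla_closure:
  fixes Y :: "'x::order set"
  assumes pjs: "pseudo_join_semilattice TYPE('x)" and B: "infinite B" and Y: "|Y| \<le>o |B|"
  shows "|nabla_closure Y| \<le>o |B|"
proof -
  have "|UNIV :: nat set| \<le>o |B|" using B by (simp add: infinite_iff_card_of_nat)
  then have "|\<Union>n. nabla_iter Y n| \<le>o |B|"
    using card_of_nabla_iter[OF assms] by (intro card_of_UNION_ordLeq_infinite[OF B]) auto
  then show ?thesis
    using card_of_mono1[OF nabla_closure_subset_iter[OF pjs]] ordLeq_transitive by blast
qed

text \<open>If \<open>lam\<close> is countable, \<open>Y\<close> is finite and supportedness makes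
  its closure finite. If \<open>lam\<close> is uncountable, the closure has at most
  \<open>|Y|\<close> plus countably many elements, which is still below \<open>lam\<close>.\<close>

lemma card_of_nabla_closure_ordLess:
  fixes Y :: "'x::order set" and lam :: "'l rel"
  assumes pjs: "pseudo_join_semilattice TYPE('x)"
    and lam: "Card_order lam" "infinite (Field lam)"
    and supp: "lam =o natLeq \<longrightarrow> supported TYPE('x)" and Y: "|Y| <o lam"
  shows "|nabla_closure Y| <o lam"
proof (cases "lam =o natLeq")
  case True
  have "finite Y" using ordLess_ordIso_trans[OF Y True] by (simp add: finite_iff_ordLess_natLeq)
  then have "finite (nabla_closure Y)" using True supp by (auto simp: supported_def)
  then show ?thesis
    using lam by (simp add: finite_ordLess_Card_order)
next
  case False
  have "natLeq \<le>o lam" using lam natLeq_ordLeq_cinfinite by (auto simp: cinfinite_def)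
  then have nat: "|UNIV :: nat set| <o lam"
    using False card_of_nat ordIso_ordLess_trans ordIso_symmetric
    by (metis ordLeq_iff_ordLess_or_ordIso)
  \<comment> \<open>The natural numbers are added to obtain an infinite bounding set even when
    \<open>Y\<close> is finite.\<close>
  have "|Y <+> (UNIV :: nat set)| <o lam"
    using card_of_Plus_ordLess_infinite_Field[OF lam(2,1) Y nat] .
  moreover have "infinite (Y <+> (UNIV :: nat set))" by (simp add: finite_Plus_iff)
  ultimately show ?thesis
    using card_of_nabla_closure[OF pjs _ card_of_Plus1] ordLeq_ordLess_trans by blast
qed

section \<open>The poset of small subsets\<close>

lemma directed_small_subsets:
  assumes "Card_order lam" "infinite (Field lam)"
  shows "directed_poset (small_subsets lam \<Omega>) (\<subseteq>)"
proof -
  have "{} \<in> small_subsets lam \<Omega>"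
    using assms by (simp add: small_subsets_def finite_ordLess_Card_order)
  moreover have "x \<union> y \<in> small_subsets lam \<Omega>" if "x \<in> small_subsets lam \<Omega>" "y \<in> small_subsets lam \<Omega>" for x y
    using that assms by (auto simp: small_subsets_def intro: card_of_Un_ordLess_infinite_Field)
  ultimately show ?thesis unfolding directed_poset_def by (intro conjI) blast+
qed

lemma Union_small_subsets:
  assumes "Card_order lam" "infinite (Field lam)"
  shows "\<Union>(small_subsets lam \<Omega>) = \<Omega>"
proof -
  have "{x} \<in> small_subsets lam \<Omega>" if "x \<in> \<Omega>" for x
    using assms that by (simp add: small_subsets_def finite_ordLess_Card_order)
  then show ?thesis by (auto simp: small_subsets_def)
qed

text \<open>A subset of a small set is small, so the union, being contained in the supremum
  \<open>w\<close>, itself belongs to the poset.\<close>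

lemma sup_in_small_subsets:
  assumes "J \<subseteq> small_subsets lam \<Omega>" "is_sup_in (small_subsets lam \<Omega>) (\<subseteq>) J w"
  shows "w = \<Union>J"
proof
  have w: "\<Union>J \<subseteq> w" "w \<subseteq> \<Omega>" "|w| <o lam" using assms(2) by (auto simp: is_sup_in_def small_subsets_def)
  then have "\<Union>J \<in> small_subsets lam \<Omega>"
    using card_of_mono1[OF w(1)] by (auto simp: small_subsets_def intro: ordLeq_ordLess_trans)
  then show "w \<subseteq> \<Union>J" using assms(2) by (auto simp: is_sup_in_def)
  show "\<Union>J \<subseteq> w" by fact
qed

section \<open>Boolean algebras\<close>

context boolean_alg
begin

lemma meet_idem: assumes x: "x \<in> carr A" shows "meet A x x = x"
proof -
  have "x = meet A x (join A x (neg A x))" using x by (simp add: join_neg meet_one)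
  also have "\<dots> = join A (meet A x x) (meet A x (neg A x))"
    using x by (simp only: meet_join_distrib neg_in)
  also have "\<dots> = meet A x x" using x by (simp add: meet_neg join_zero meet_in)
  finally show ?thesis by simp
qed

lemma meet_zero: assumes x: "x \<in> carr A" shows "meet A x (bzero A) = bzero A"
proof -
  have "meet A x (bzero A) = meet A (meet A x x) (neg A x)"
    using x by (simp add: meet_assoc meet_neg neg_in)
  then show ?thesis using x by (simp add: meet_idem meet_neg)
qed

lemma absorb: assumes x: "x \<in> carr A" and y: "y \<in> carr A" shows "meet A x (join A x y) = x"
proof -
  have "meet A x (join A x y) = meet A (join A x (bzero A)) (join A x y)"
    using x by (simp add: join_zero)
  also have "\<dots> = join A x (meet A (bzero A) y)"
    using x y by (simp only: join_meet_distrib zero_in)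
  also have "\<dots> = x" using x y by (simp add: meet_comm[of "bzero A"] zero_in meet_zero join_zero)
  finally show ?thesis .
qed

lemma ble_trans:
  "x \<in> carr A \<Longrightarrow> y \<in> carr A \<Longrightarrow> z \<in> carr A \<Longrightarrow> ble A x y \<Longrightarrow> ble A y z \<Longrightarrow> ble A x z"
  by (metis ble_def meet_assoc)

lemma meet_mono1:
  "x \<in> carr A \<Longrightarrow> y \<in> carr A \<Longrightarrow> z \<in> carr A \<Longrightarrow> ble A x y \<Longrightarrow> ble A (meet A x z) (meet A y z)"
proof -
  assume xyz: "x \<in> carr A" "y \<in> carr A" "z \<in> carr A" and "ble A x y"
  then have "meet A x y = x" by (simp add: ble_def)
  have "meet A (meet A x z) (meet A y z) = meet A (meet A x (meet A z z)) y"
    using xyz by (simp only: meet_assoc meet_in meet_comm[of y z] flip: meet_assoc)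
  also have "\<dots> = meet A (meet A x z) y" using xyz by (simp add: meet_idem)
  also have "\<dots> = meet A (meet A x y) z"
    using xyz by (simp only: meet_assoc meet_comm[of y z])
  finally show ?thesis using \<open>meet A x y = x\<close> by (simp add: ble_def)
qed

lemma join_upper1: "x \<in> carr A \<Longrightarrow> y \<in> carr A \<Longrightarrow> ble A x (join A x y)"
  by (simp add: ble_def absorb)

lemma join_upper2: "x \<in> carr A \<Longrightarrow> y \<in> carr A \<Longrightarrow> ble A y (join A x y)"
  using join_upper1[of y x] by (simp add: join_comm)

lemma ble_one: "x \<in> carr A \<Longrightarrow> ble A x (bone A)"
  by (simp add: ble_def meet_one)

lemma balg_ideal_carr: "balg_ideal A (carr A)"
  by (auto simp: balg_ideal_def zero_in join_in)

lemma balg_ideal_ideal_gen: "S \<subseteq> carr A \<Longrightarrow> balg_ideal A (ideal_gen A S)"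
  using balg_ideal_carr unfolding balg_ideal_def ideal_gen_def by blast

text \<open>The elements of the carrier that satisfy \<open>P\<close> form an ideal containing
  \<open>S\<close>.\<close>

lemma ideal_gen_induct [consumes 2, case_names zero gen join lower]:
  assumes "x \<in> ideal_gen A S" "S \<subseteq> carr A"
    and "P (bzero A)" "\<And>s. s \<in> S \<Longrightarrow> P s"
    and "\<And>x y. x \<in> carr A \<Longrightarrow> y \<in> carr A \<Longrightarrow> P x \<Longrightarrow> P y \<Longrightarrow> P (join A x y)"
    and "\<And>x y. x \<in> carr A \<Longrightarrow> y \<in> carr A \<Longrightarrow> P x \<Longrightarrow> ble A y x \<Longrightarrow> P y"
  shows "P x"
proof -
  have "balg_ideal A {x \<in> carr A. P x}"
    using assms(3,5,6) by (auto simp: balg_ideal_def zero_in join_in)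
  moreover have "S \<subseteq> {x \<in> carr A. P x}" using assms(2,4) by auto
  ultimately show ?thesis using assms(1) by (auto simp: ideal_gen_def)
qed

lemma finite_ideal_bound:
  assumes "balg_ideal A I" "finite S" "S \<subseteq> I"
  shows "\<exists>b\<in>I. \<forall>s\<in>S. ble A s b"
  using assms(2,3)
proof induction
  case empty
  then show ?case using assms(1) by (auto simp: balg_ideal_def)
next
  case (insert s S)
  then obtain b where b: "b \<in> I" "\<forall>s\<in>S. ble A s b" by auto
  have carr: "I \<subseteq> carr A" using assms(1) by (auto simp: balg_ideal_def)
  have "join A s b \<in> I" using assms(1) b insert.prems by (auto simp: balg_ideal_def)
  moreover have "ble A t (join A s b)" if "t \<in> S" for t
    using that insert.prems b carr
    by (meson ble_trans insert_subset join_in join_upper2 subset_iff)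
  moreover have "ble A s (join A s b)"
    using insert.prems b(1) carr by (intro join_upper1) auto
  ultimately show ?case by (metis insert_iff)
qed

end

lemma ideal_gen_superset: "S \<subseteq> ideal_gen A S"
  by (auto simp: ideal_gen_def)

lemma ideal_gen_least: "balg_ideal A I \<Longrightarrow> S \<subseteq> I \<Longrightarrow> ideal_gen A S \<subseteq> I"
  by (auto simp: ideal_gen_def)

subsection \<open>Subalgebras\<close>

inductive_set span :: "('u, 'z) balg_scheme \<Rightarrow> 'u set \<Rightarrow> 'u set"
  for A :: "('u, 'z) balg_scheme" and G :: "'u set" where
  gen: "x \<in> G \<Longrightarrow> x \<in> span A G"
| meet: "x \<in> span A G \<Longrightarrow> y \<in> span A G \<Longrightarrow> meet A x y \<in> span A G"
| join: "x \<in> span A G \<Longrightarrow> y \<in> span A G \<Longrightarrow> join A x y \<in> span A G"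
| neg: "x \<in> span A G \<Longrightarrow> neg A x \<in> span A G"
| zero: "bzero A \<in> span A G"
| one: "bone A \<in> span A G"

lemma span_mono:
  assumes "G \<subseteq> H" shows "span A G \<subseteq> span A H"
proof
  fix x assume "x \<in> span A G"
  then show "x \<in> span A H" by induction (use assms in \<open>auto intro: span.intros\<close>)
qed

lemma (in boolean_alg) span_subset:
  assumes "G \<subseteq> carr A" shows "span A G \<subseteq> carr A"
proof
  fix x assume "x \<in> span A G"
  then show "x \<in> carr A"
    by induction (use assms in \<open>auto intro: meet_in join_in neg_in zero_in one_in\<close>)
qed

text \<open>The Boolean operations are finitary: two arguments from different members of the union
  are combined in a common later member.\<close>

lemma span_directed_Union:
  assumes dir: "directed_poset I le"
    and mono: "\<And>i j. i \<in> I \<Longrightarrow> j \<in> I \<Longrightarrow> le i j \<Longrightarrow> G i \<subseteq> G j"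
  shows "span A (\<Union>i\<in>I. G i) = (\<Union>i\<in>I. span A (G i))"
proof
  have binary: "\<exists>k\<in>I. x \<in> span A (G k) \<and> y \<in> span A (G k)"
    if xy: "x \<in> (\<Union>i\<in>I. span A (G i))" "y \<in> (\<Union>i\<in>I. span A (G i))" for x y
  proof -
    obtain i j where ij: "i \<in> I" "j \<in> I" "x \<in> span A (G i)" "y \<in> span A (G j)" using xy by blast
    then obtain k where "k \<in> I" "le i k" "le j k" using directed_poset_bound[OF dir] by metis
    then show ?thesis using ij mono span_mono[of "G i" "G k" A] span_mono[of "G j" "G k" A] by blast
  qed
  obtain i where i: "i \<in> I" using dir by (auto simp only: directed_poset_def)
  show "span A (\<Union>i\<in>I. G i) \<subseteq> (\<Union>i\<in>I. span A (G i))"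
  proof
    fix x assume "x \<in> span A (\<Union>i\<in>I. G i)"
    then show "x \<in> (\<Union>i\<in>I. span A (G i))"
    proof induction
      case (meet x y)
      then show ?case using binary[of x y] by (blast intro: span.meet)
    next
      case (join x y)
      then show ?case using binary[of x y] by (blast intro: span.join)
    qed (use i in \<open>blast intro: span.intros\<close>)+
  qed
  show "(\<Union>i\<in>I. span A (G i)) \<subseteq> span A (\<Union>i\<in>I. G i)"
    using span_mono[of "G _" "\<Union>i\<in>I. G i" A] by blast
qed

lemma boolean_alg_span:
  fixes A :: "('u, 'p) scaled"
  assumes "boolean_alg A" "G \<subseteq> carr A"
  shows "boolean_alg (A\<lparr>carr := span A G, scale := s\<rparr>)"
proof -
  interpret boolean_alg A by fact
  note sub = subsetD[OF span_subset[OF assms(2)]]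
  show ?thesis
    by unfold_locales
       (auto intro: span.intros
         simp: sub meet_comm join_comm meet_assoc join_assoc meet_join_distrib join_meet_distrib
               meet_one join_zero meet_neg join_neg)
qed

lemma boolean_alg_transfer:
  assumes "boolean_alg A" "carr B = carr A" "meet B = meet A" "join B = join A" "neg B = neg A"
    "bzero B = bzero A" "bone B = bone A"
  shows "boolean_alg B"
proof -
  interpret boolean_alg A by fact
  show ?thesis
    by (unfold_locales, unfold assms(2-7))
       (fact meet_in join_in neg_in zero_in one_in meet_comm join_comm meet_assoc
          join_assoc meet_join_distrib join_meet_distrib meet_one join_zero meet_neg join_neg)+
qed

text \<open>Agreement spreads from generators to the carrier by induction over \<open>span\<close>;
  extensionality turns this into equality of functions.\<close>

lemma bhom_span_eqI:
  assumes "boolean_alg A" "G \<subseteq> carr A" "carr C = span A G" "meet C = meet A" "join C = join A"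
    "neg C = neg A" "bzero C = bzero A" "bone C = bone A"
    and f: "f \<in> bhom C B" and g: "g \<in> bhom C B" and eq: "\<And>x. x \<in> G \<Longrightarrow> f x = g x"
  shows "f = g"
proof (rule extensionalityI)
  show "f \<in> extensional (carr C)" "g \<in> extensional (carr C)"
    using f g by (auto simp: bhom_def PiE_def)
  fix x assume "x \<in> carr C"
  then have "x \<in> span A G" using assms(3) by simp
  then show "f x = g x"
    by induction (use f g eq assms(3-8) in \<open>auto simp: bhom_def\<close>)
qed

section \<open>The algebras generated by nabla-closed subsets\<close>

text \<open>The ideals are generated inside the subalgebra by the generators from \<open>Z\<close>,
  instead of being traces of the ideals of \<open>A\<close>. In this form they commute with directed
  unions of index sets.\<close>

definition sub_F :: "('x::order \<Rightarrow> 'p::order) \<Rightarrow> ('u, 'p) scaled \<Rightarrow> ('x \<Rightarrow> 'u) \<Rightarrow> 'x set \<Rightarrow> ('u, 'p) scaled"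
  where
  "sub_F d A gen Z = A\<lparr>carr := span A (gen ` Z),
     scale := (\<lambda>p. ideal_gen (A\<lparr>carr := span A (gen ` Z)\<rparr>) {gen u | u. u \<in> Z \<and> p \<le> d u})\<rparr>"

definition incl_arrow :: "('u, 'p::order) scaled \<Rightarrow> ('u, 'p) scaled \<Rightarrow> ('u, 'p) scaled_arrow" where
  "incl_arrow A B = (A, \<lambda>x\<in>carr A. x, B)"

lemma sub_F_simps [simp]:
  "carr (sub_F d A gen Z) = span A (gen ` Z)" "meet (sub_F d A gen Z) = meet A"
  "join (sub_F d A gen Z) = join A" "neg (sub_F d A gen Z) = neg A"
  "bzero (sub_F d A gen Z) = bzero A" "bone (sub_F d A gen Z) = bone A"
  "ble (sub_F d A gen Z) = ble A"
  by (simp_all add: sub_F_def ble_def fun_eq_iff)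

text \<open>\<open>ideal_gen\<close> reads only the carrier and the Boolean operations, so replacing
  the scale component of the record does not affect it.\<close>

lemma scale_sub_F:
  "scale (sub_F d A gen Z) p = ideal_gen (sub_F d A gen Z) {gen u | u. u \<in> Z \<and> p \<le> d u}"
  by (simp add: sub_F_def ideal_gen_def balg_ideal_def ble_def)

section \<open>Arrows of \<open>BoolP\<close>\<close>

lemma Hom_BoolP_iff:
  "m \<in> Hom BoolP A B \<longleftrightarrow> (\<exists>f. m = (A, f, B) \<and> scaled_boolean_algebra A \<and> scaled_boolean_algebra B \<and>
     f \<in> bhom A B \<and> (\<forall>p. f ` scale A p \<subseteq> scale B p))"
  by (auto simp: Hom_def BoolP_def)

lemma cmp_BoolP [simp]:
  "cmp BoolP (B', g, C) (A, f, B) = (A, compose (carr A) g f, C)"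
  by (simp add: BoolP_def)

lemma scale_subset_carr: "scaled_boolean_algebra A \<Longrightarrow> scale A p \<subseteq> carr A"
  unfolding scaled_boolean_algebra_def balg_ideal_def by blast

lemma cmp_BoolP_in:
  assumes "m \<in> Hom BoolP A B" "n \<in> Hom BoolP B C"
  shows "n \<cdot>\<^bsub>BoolP\<^esub> m \<in> Hom BoolP A C"
proof -
  obtain f where f: "m = (A, f, B)" "scaled_boolean_algebra A" "f \<in> bhom A B" "\<And>p. f ` scale A p \<subseteq> scale B p"
    using assms(1) unfolding Hom_BoolP_iff by blast
  obtain g where g: "n = (B, g, C)" "scaled_boolean_algebra C" "g \<in> bhom B C" "\<And>p. g ` scale B p \<subseteq> scale C p"
    using assms(2) unfolding Hom_BoolP_iff by blast
  have A: "boolean_alg A" "\<And>p. scale A p \<subseteq> carr A"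
    using f(2) by (simp add: scaled_boolean_algebra_def) (rule scale_subset_carr[OF f(2)])
  have "compose (carr A) g f \<in> bhom A C"
    using f(3) g(3) boolean_alg.meet_in[OF A(1)] boolean_alg.join_in[OF A(1)] boolean_alg.neg_in[OF A(1)]
      boolean_alg.zero_in[OF A(1)] boolean_alg.one_in[OF A(1)]
    by (auto simp: bhom_def compose_def PiE_def Pi_def)
  moreover have "compose (carr A) g f ` scale A p \<subseteq> scale C p" for p
    using f(4)[of p] g(4)[of p] A(2)[of p] by (auto simp: compose_def)
  ultimately show ?thesis using f(1,2) g(1,2) by (auto simp: Hom_BoolP_iff)
qed

lemma boolean_alg_sub_F:
  assumes "boolean_alg A" "gen ` Z \<subseteq> carr A"
  shows "boolean_alg (sub_F d A gen Z)"
  unfolding sub_F_def by (rule boolean_alg_span[OF assms])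

text \<open>Collects what the subalgebras take from \<open>F(X)\<close>: nontriviality and the
  defining relations. The universal property enters separately, through \<open>is_F\<close>.\<close>

locale covering_algebra =
  fixes d :: "'x::order \<Rightarrow> 'p::order" and A :: "('u, 'p) scaled" and gen :: "'x \<Rightarrow> 'u"
  assumes pjs: "pseudo_join_semilattice TYPE('x)" and d: "mono d"
    and A: "boolean_alg A" "bzero A \<noteq> bone A" and rel: "F_relations A gen"
begin

sublocale A: boolean_alg A by (fact A)

lemma gen_carr: "gen ` Z \<subseteq> carr A"
  using rel by (auto simp: F_relations_def)

lemma span_carr: "x \<in> span A (gen ` Z) \<Longrightarrow> x \<in> carr A"
  using A.span_subset[OF gen_carr] by blast

lemma gen_scale_subset: "{gen u | u. u \<in> Z \<and> p \<le> d u} \<subseteq> carr (sub_F d A gen Z)"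
  by (auto intro: span.gen)

lemma gen_in_scale: "u \<in> Z \<Longrightarrow> p \<le> d u \<Longrightarrow> gen u \<in> scale (sub_F d A gen Z) p"
  unfolding scale_sub_F by (rule subsetD[OF ideal_gen_superset]) blast

lemma balg_ideal_scale: "balg_ideal (sub_F d A gen Z) (scale (sub_F d A gen Z) p)"
  unfolding scale_sub_F
  by (intro boolean_alg.balg_ideal_ideal_gen boolean_alg_sub_F A(1) gen_carr gen_scale_subset)

text \<open>The trace on the smaller algebra of an ideal of the larger one is again an ideal, and it
  contains the generators in question.\<close>

lemma scale_mono:
  assumes "Z \<subseteq> Z'" shows "scale (sub_F d A gen Z) p \<subseteq> scale (sub_F d A gen Z') p"
proof
  interpret Z: boolean_alg "sub_F d A gen Z" by (rule boolean_alg_sub_F[OF A(1) gen_carr])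
  have carr: "span A (gen ` Z) \<subseteq> span A (gen ` Z')" using assms by (intro span_mono) auto
  note I = balg_ideal_scale[of Z' p, unfolded balg_ideal_def, simplified]
  fix x assume "x \<in> scale (sub_F d A gen Z) p"
  then have "x \<in> ideal_gen (sub_F d A gen Z) {gen u | u. u \<in> Z \<and> p \<le> d u}"
    by (simp only: scale_sub_F)
  then show "x \<in> scale (sub_F d A gen Z') p"
    using gen_scale_subset
  proof (induction rule: Z.ideal_gen_induct)
    case zero
    then show ?case using I by simp
  next
    case (gen s)
    then show ?case using assms gen_in_scale by blast
  next
    case (join x y)
    then show ?case using I by simp
  next
    case (lower x y)
    then show ?case using I carr by auto
  qed
qed

text \<open>Nabla-closedness keeps inside \<open>Z\<close> the index sets of both kinds of join in
  \<open>F_relations\<close>. The unit is a join of generators at minimal elements, which gives the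
  first axiom. A meet of two generators is a join of generators at \<open>nabla {u, v}\<close>,
  whose norms dominate both given norms, which gives the second.\<close>

lemma scaled_boolean_algebra_sub_F:
  assumes Z: "nabla_closed Z"
  shows "scaled_boolean_algebra (sub_F d A gen Z)"
proof -
  define B where "B = sub_F d A gen Z"
  have B: "boolean_alg B" unfolding B_def by (rule boolean_alg_sub_F[OF A(1) gen_carr])
  interpret B: boolean_alg B by (fact B)
  have [simp]: "meet B = meet A" "join B = join A" "bzero B = bzero A" "bone B = bone A"
    "ble B = ble A" "neg B = neg A"
    by (simp_all add: B_def)
  have I: "balg_ideal B (scale B p)" for p unfolding B_def by (rule balg_ideal_scale)
  have scarr: "scale B p \<subseteq> carr B" for p using I by (auto simp: balg_ideal_def)
  have gens: "{gen u | u. u \<in> Z \<and> p \<le> d u} \<subseteq> carr B" for p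
    unfolding B_def by (rule gen_scale_subset)
  have scale: "scale B p = ideal_gen B {gen u | u. u \<in> Z \<and> p \<le> d u}" for p
    unfolding B_def by (rule scale_sub_F)
  have genB: "u \<in> Z \<Longrightarrow> gen u \<in> carr B" for u by (auto simp: B_def intro: span.gen)
  \<comment> \<open>The join is taken in \<open>A\<close>, whereas \<open>J\<close> is an ideal of
    \<open>B\<close>. Being finite, \<open>S\<close> has an upper bound \<open>b\<close> in
    \<open>J\<close>; since \<open>b\<close> also lies in \<open>A\<close>, the join
    \<open>j\<close> is below it.\<close>
  have join_in_ideal: "j \<in> J"
    if J: "balg_ideal B J" and j: "is_join A S j" "j \<in> carr B" "finite S" "S \<subseteq> J" for j S J
  proof -
    obtain b where b: "b \<in> J" "\<forall>s\<in>S. ble B s b" using B.finite_ideal_bound[OF J j(3,4)] by blast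
    have "b \<in> carr A" using b(1) J span_carr[of _ Z] by (auto simp: balg_ideal_def B_def)
    then have "ble A j b" using j(1) b(2) by (auto simp: is_join_def is_sup_in_def)
    then show ?thesis using J b(1) j(2) by (auto simp: balg_ideal_def)
  qed

  have "carr B = ideal_gen B (\<Union>p. scale B p)"
  proof
    let ?J = "ideal_gen B (\<Union>p. scale B p)"
    have J: "balg_ideal B ?J" using scarr by (intro B.balg_ideal_ideal_gen) blast
    have min: "{u. \<forall>v. v \<le> u \<longrightarrow> v = u} \<subseteq> Z" "finite {u::'x. \<forall>v. v \<le> u \<longrightarrow> v = u}"
      using Z finite_nabla[OF pjs, of "{}"] by (auto simp: nabla_closed_def simp flip: nabla_empty)
    have "gen u \<in> ?J" if "u \<in> Z" for u
      using that gen_in_scale[of u Z "d u"] ideal_gen_superset[of "\<Union>p. scale B p" B]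
      by (auto simp: B_def)
    then have "bone A \<in> ?J"
      using J rel min B.one_in by (intro join_in_ideal[OF J]) (auto simp: F_relations_def)
    then show "carr B \<subseteq> ?J" using J B.ble_one by (auto simp: balg_ideal_def)
    show "?J \<subseteq> carr B" using J by (auto simp: balg_ideal_def)
  qed
  moreover have "scale B p \<inter> scale B q = ideal_gen B (\<Union>r \<in> {r. p \<le> r \<and> q \<le> r}. scale B r)" for p q
  proof
    let ?J = "ideal_gen B (\<Union>r \<in> {r. p \<le> r \<and> q \<le> r}. scale B r)"
    have J: "balg_ideal B ?J" using scarr by (intro B.balg_ideal_ideal_gen) blast
    note J' = J[unfolded balg_ideal_def]
    \<comment> \<open>Each \<open>w\<close> in \<open>nabla {u, v}\<close> satisfies
      \<open>p \<le> d w\<close> and \<open>q \<le> d w\<close> by isotonicity, so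
      \<open>r = d w\<close> witnesses that \<open>gen w\<close> lies in \<open>?J\<close>.\<close>
    have gg: "meet A (gen u) (gen v) \<in> ?J" if u: "u \<in> Z" "p \<le> d u" and v: "v \<in> Z" "q \<le> d v" for u v
    proof (rule join_in_ideal[OF J])
      show "is_join A (gen ` nabla {u, v}) (meet A (gen u) (gen v))"
        using rel by (auto simp: F_relations_def)
      show "meet A (gen u) (gen v) \<in> carr B" using B.meet_in[of "gen u" "gen v"] genB u v by simp
      show "finite (gen ` nabla {u, v})" using finite_nabla[OF pjs, of "{u, v}"] by simp
      show "gen ` nabla {u, v} \<subseteq> ?J"
      proof
        fix y assume "y \<in> gen ` nabla {u, v}"
        then obtain w where w: "w \<in> nabla {u, v}" "y = gen w" by blast
        then have "p \<le> d w" "q \<le> d w"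
          using u(2) v(2) monoD[OF d] nabla_upper[OF w(1)] by (meson insertCI order.trans)+
        moreover have "w \<in> Z" using Z[unfolded nabla_closed_def, rule_format, of "{u, v}"] u v w(1) by auto
        ultimately show "y \<in> ?J"
          using gen_in_scale[of w Z "d w"] w(2) ideal_gen_superset[of "\<Union>r \<in> {r. p \<le> r \<and> q \<le> r}. scale B r" B]
          by (auto simp: B_def)
      qed
    qed
    \<comment> \<open>Distributivity extends the statement from generators to whole ideals, one
      argument at a time.\<close>
    have gy: "meet A (gen u) y \<in> ?J" if u: "u \<in> Z" "p \<le> d u" and y: "y \<in> scale B q" for u y
      using y[unfolded scale] gens
    proof (induction rule: B.ideal_gen_induct)
      case zero
      then show ?case using J' B.meet_zero[of "gen u"] genB u by simp
    next
      case (gen s)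
      then show ?case using gg u by blast
    next
      case (join x y)
      then show ?case using J' B.meet_join_distrib[of "gen u" x y] genB u by simp
    next
      case (lower x y)
      then have "ble B (meet B y (gen u)) (meet B x (gen u))" using genB u by (intro B.meet_mono1) auto
      then have "ble A (meet A (gen u) y) (meet A (gen u) x)"
        using B.meet_comm[of "gen u"] genB u lower by simp
      moreover have "meet A (gen u) y \<in> carr B" using B.meet_in[of "gen u" y] genB u lower by simp
      ultimately show ?case using J' lower by auto
    qed
    have xy: "meet A x y \<in> ?J" if x: "x \<in> scale B p" and y: "y \<in> scale B q" for x y
      using x[unfolded scale] gens
    proof (induction rule: B.ideal_gen_induct)
      case zero
      have "meet A (bzero A) y = bzero A"
        using B.meet_zero[of y] B.meet_comm[of "bzero A" y] B.zero_in y scarr by auto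
      then show ?case using J' by simp
    next
      case (gen s)
      then show ?case using gy y by blast
    next
      case (join x x')
      have y': "y \<in> carr B" using y scarr by blast
      have "meet A (join A x x') y = join A (meet A x y) (meet A x' y)"
        using B.meet_join_distrib[of y x x'] B.meet_comm[of y] B.join_in[of x x'] join y' by simp
      then show ?case using J' join by simp
    next
      case (lower x x')
      have y': "y \<in> carr B" using y scarr by blast
      then have "ble B (meet B x' y) (meet B x y)" using lower by (intro B.meet_mono1) auto
      moreover have "meet A x' y \<in> carr B" using B.meet_in[of x' y] y' lower by simp
      ultimately show ?case using J' lower by auto
    qed
    show "scale B p \<inter> scale B q \<subseteq> ?J"
    proof
      fix x assume x: "x \<in> scale B p \<inter> scale B q"
      \<comment> \<open>An element of both ideals is its own meet with itself, so the statement on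
        meets covers the intersection.\<close>
      then have "meet A x x \<in> ?J" using xy by blast
      moreover have "meet A x x = x" using B.meet_idem[of x] x scarr by auto
      ultimately show "x \<in> ?J" by simp
    qed
    have anti: "scale B r \<subseteq> scale B s" if "s \<le> r" for r s
      unfolding scale[of r]
      by (rule ideal_gen_least[OF I]) (use that gen_in_scale in \<open>auto simp: B_def intro: order.trans\<close>)
    show "?J \<subseteq> scale B p \<inter> scale B q"
      using anti by (intro Int_greatest ideal_gen_least[OF I]) blast+
  qed
  ultimately show ?thesis using B I A(2) unfolding scaled_boolean_algebra_def B_def by simp
qed

lemma incl_arrow_in:
  assumes "nabla_closed Z" "nabla_closed Z'" "Z \<subseteq> Z'"
  shows "incl_arrow (sub_F d A gen Z) (sub_F d A gen Z') \<in> Hom BoolP (sub_F d A gen Z) (sub_F d A gen Z')"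
proof -
  have carr: "span A (gen ` Z) \<subseteq> span A (gen ` Z')" using assms by (intro span_mono) auto
  have "(\<lambda>x\<in>carr (sub_F d A gen Z). x) \<in> bhom (sub_F d A gen Z) (sub_F d A gen Z')"
    using carr by (auto simp: bhom_def intro: span.intros)
  moreover have "(\<lambda>x\<in>carr (sub_F d A gen Z). x) ` scale (sub_F d A gen Z) p \<subseteq> scale (sub_F d A gen Z') p" for p
    using scale_mono[OF assms(3), of p] balg_ideal_scale[of Z p] by (auto simp: balg_ideal_def)
  ultimately show ?thesis
    using assms by (simp add: Hom_BoolP_iff incl_arrow_def scaled_boolean_algebra_sub_F)
qed

end

section \<open>Directed colimits of the subalgebras\<close>

lemma incl_arrow_cmp:
  "carr A \<subseteq> carr B \<Longrightarrow> incl_arrow B C \<cdot>\<^bsub>BoolP\<^esub> incl_arrow A B = incl_arrow A C"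
  by (auto simp: incl_arrow_def compose_def restrict_def fun_eq_iff)

context covering_algebra
begin

context
  fixes I :: "'i set" and le :: "'i \<Rightarrow> 'i \<Rightarrow> bool" and K :: "'i \<Rightarrow> 'x set"
  assumes dir: "directed_poset I le" and closed: "\<And>i. i \<in> I \<Longrightarrow> nabla_closed (K i)"
    and mono: "\<And>i j. i \<in> I \<Longrightarrow> j \<in> I \<Longrightarrow> le i j \<Longrightarrow> K i \<subseteq> K j"
begin

lemma span_Union: "span A (gen ` (\<Union>i\<in>I. K i)) = (\<Union>i\<in>I. span A (gen ` K i))"
  unfolding image_UN by (rule span_directed_Union[OF dir]) (use mono in blast)

text \<open>Both the carrier and the generating set of the ideal over the union are directed unions,
  and each ideal-forming step involves finitely many elements, hence takes place at one
  stage.\<close>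

lemma scale_Union:
  "scale (sub_F d A gen (\<Union>i\<in>I. K i)) p = (\<Union>i\<in>I. scale (sub_F d A gen (K i)) p)"
proof
  let ?U = "\<Union>i\<in>I. K i"
  interpret U: boolean_alg "sub_F d A gen ?U" by (rule boolean_alg_sub_F[OF A(1) gen_carr])
  note I = balg_ideal_scale[of "K _" p, unfolded balg_ideal_def, simplified]
  show "(\<Union>i\<in>I. scale (sub_F d A gen (K i)) p) \<subseteq> scale (sub_F d A gen ?U) p"
    by (intro UN_least scale_mono UN_upper)
  show "scale (sub_F d A gen ?U) p \<subseteq> (\<Union>i\<in>I. scale (sub_F d A gen (K i)) p)"
  proof
    fix x assume "x \<in> scale (sub_F d A gen ?U) p"
    then have "x \<in> ideal_gen (sub_F d A gen ?U) {gen u | u. u \<in> ?U \<and> p \<le> d u}"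
      by (simp only: scale_sub_F)
    then show "x \<in> (\<Union>i\<in>I. scale (sub_F d A gen (K i)) p)"
      using gen_scale_subset
    proof (induction rule: U.ideal_gen_induct)
      case zero
      obtain i where "i \<in> I" using dir by (auto simp only: directed_poset_def)
      then show ?case using I[of i] by auto
    next
      case (gen s)
      then show ?case using gen_in_scale by blast
    next
      case (join x y)
      then obtain i j where ij: "i \<in> I" "j \<in> I" "x \<in> scale (sub_F d A gen (K i)) p"
        "y \<in> scale (sub_F d A gen (K j)) p" by blast
      then obtain k where k: "k \<in> I" "le i k" "le j k" using directed_poset_bound[OF dir] by metis
      then have "x \<in> scale (sub_F d A gen (K k)) p" "y \<in> scale (sub_F d A gen (K k)) p"
        using ij mono scale_mono by blast+
      then show ?case using I[of k] k(1) by auto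
    next
      \<comment> \<open>A stage \<open>k\<close> is needed at which \<open>x\<close> is in the ideal
        and, at the same time, \<open>y\<close> is in the carrier.\<close>
      case (lower x y)
      then obtain i j where ij: "i \<in> I" "j \<in> I" "x \<in> scale (sub_F d A gen (K i)) p"
        "y \<in> span A (gen ` K j)" by (auto simp: span_Union)
      then obtain k where k: "k \<in> I" "le i k" "le j k" using directed_poset_bound[OF dir] by metis
      have "x \<in> scale (sub_F d A gen (K k)) p" using ij k mono scale_mono by blast
      moreover have "y \<in> span A (gen ` K k)"
        using ij k mono span_mono[of "gen ` K j" "gen ` K k" A] by blast
      moreover have "ble A y x" using lower by simp
      ultimately have "y \<in> scale (sub_F d A gen (K k)) p" using I[of k] by blast
      then show ?case using k(1) by blast
    qed
  qed
qed

lemma cocone_sub_F: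
  "cocone BoolP I le (\<lambda>i. sub_F d A gen (K i))
     (\<lambda>i j. incl_arrow (sub_F d A gen (K i)) (sub_F d A gen (K j)))
     (sub_F d A gen (\<Union>i\<in>I. K i)) (\<lambda>i. incl_arrow (sub_F d A gen (K i)) (sub_F d A gen (\<Union>i\<in>I. K i)))"
proof -
  have cl: "nabla_closed (\<Union>i\<in>I. K i)" using nabla_closed_directed_Union[OF dir closed mono] .
  have "sub_F d A gen (\<Union>i\<in>I. K i) \<in> Ob BoolP"
    using scaled_boolean_algebra_sub_F[OF cl] by (simp add: BoolP_def)
  moreover have "incl_arrow (sub_F d A gen (K i)) (sub_F d A gen (\<Union>i\<in>I. K i))
      \<in> Hom BoolP (sub_F d A gen (K i)) (sub_F d A gen (\<Union>i\<in>I. K i))" if "i \<in> I" for i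
    by (intro incl_arrow_in closed cl that UN_upper)
  moreover have "span A (gen ` K i) \<subseteq> span A (gen ` K j)" if "i \<in> I" "j \<in> I" "le i j" for i j
    by (intro span_mono image_mono mono that)
  ultimately show ?thesis by (simp add: cocone_def incl_arrow_cmp)
qed

text \<open>A cocone is a compatible family of homomorphisms on an increasing directed family of
  subalgebras, so it glues uniquely on the union. The glued map respects the ideals by
  \<open>scale_Union\<close>.\<close>

lemma colimit_sub_F:
  "colimit BoolP I le (\<lambda>i. sub_F d A gen (K i))
     (\<lambda>i j. incl_arrow (sub_F d A gen (K i)) (sub_F d A gen (K j)))
     (sub_F d A gen (\<Union>i\<in>I. K i)) (\<lambda>i. incl_arrow (sub_F d A gen (K i)) (sub_F d A gen (\<Union>i\<in>I. K i)))"
  unfolding colimit_def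
proof (intro conjI cocone_sub_F allI impI)
  fix M m
  assume M: "cocone BoolP I le (\<lambda>i. sub_F d A gen (K i))
    (\<lambda>i j. incl_arrow (sub_F d A gen (K i)) (sub_F d A gen (K j))) M m"
  define U where "U = sub_F d A gen (\<Union>i\<in>I. K i)"
  define C where "C i = span A (gen ` K i)" for i
  have CU: "carr U = (\<Union>i\<in>I. C i)" by (simp add: U_def C_def span_Union)
  have ops: "meet U = meet A" "join U = join A" "neg U = neg A" "bzero U = bzero A" "bone U = bone A"
    by (simp_all add: U_def)
  have sU: "scaled_boolean_algebra U"
    unfolding U_def by (intro scaled_boolean_algebra_sub_F nabla_closed_directed_Union[OF dir closed mono])
  have sM: "scaled_boolean_algebra M" using M by (simp add: cocone_def BoolP_def)
  have "\<exists>f. m i = (sub_F d A gen (K i), f, M) \<and> f \<in> bhom (sub_F d A gen (K i)) M \<and>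
      (\<forall>p. f ` scale (sub_F d A gen (K i)) p \<subseteq> scale M p)" if "i \<in> I" for i
    using M that unfolding cocone_def Hom_BoolP_iff by blast
  then obtain f where f: "\<And>i. i \<in> I \<Longrightarrow> m i = (sub_F d A gen (K i), f i, M)"
    "\<And>i. i \<in> I \<Longrightarrow> f i \<in> bhom (sub_F d A gen (K i)) M"
    "\<And>i p. i \<in> I \<Longrightarrow> f i ` scale (sub_F d A gen (K i)) p \<subseteq> scale M p"
    by metis
  have compat: "f j x = f i x" if ij: "i \<in> I" "j \<in> I" "le i j" and x: "x \<in> C i" for i j x
  proof -
    have "m j \<cdot>\<^bsub>BoolP\<^esub> incl_arrow (sub_F d A gen (K i)) (sub_F d A gen (K j)) = m i"
      using M ij by (simp add: cocone_def)
    then have "compose (C i) (f j) (\<lambda>x\<in>C i. x) = f i"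
      using f(1) ij by (simp add: incl_arrow_def C_def)
    then show ?thesis using x by (auto simp: compose_def fun_eq_iff split: if_splits)
  qed
  have Cmono: "C i \<subseteq> C j" if "i \<in> I" "j \<in> I" "le i j" for i j
    unfolding C_def by (intro span_mono image_mono mono that)
  \<comment> \<open>The stage used to evaluate \<open>h\<close> at \<open>x\<close> is arbitrary;
    directedness and \<open>compat\<close> make the value independent of it.\<close>
  define h where "h = (\<lambda>x\<in>carr U. f (SOME i. i \<in> I \<and> x \<in> C i) x)"
  have h: "h x = f i x" if i: "i \<in> I" "x \<in> C i" for i x
  proof -
    define j where "j = (SOME i. i \<in> I \<and> x \<in> C i)"
    have j: "j \<in> I" "x \<in> C j" unfolding j_def using someI[of "\<lambda>i. i \<in> I \<and> x \<in> C i" i] i by auto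
    obtain k where k: "k \<in> I" "le i k" "le j k" using directed_poset_bound[OF dir i(1) j(1)] by metis
    have "h x = f j x" using i by (auto simp: h_def CU j_def)
    also have "\<dots> = f i x" using compat[of j k x] compat[of i k x] i j k by simp
    finally show ?thesis .
  qed
  have common: "\<exists>k\<in>I. x \<in> C k \<and> y \<in> C k" if xy: "x \<in> carr U" "y \<in> carr U" for x y
  proof -
    obtain i j where ij: "i \<in> I" "j \<in> I" "x \<in> C i" "y \<in> C j" using xy CU by auto
    obtain k where k: "k \<in> I" "le i k" "le j k" using directed_poset_bound[OF dir ij(1,2)] by metis
    then show ?thesis using Cmono[of i k] Cmono[of j k] ij by blast
  qed
  have fC: "f i x \<in> carr M" "f i (neg A x) = neg M (f i x)" if "i \<in> I" "x \<in> C i" for i x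
    using f(2)[OF that(1)] that(2) by (auto simp: bhom_def C_def)
  have fC2: "f i (meet A x y) = meet M (f i x) (f i y)" "f i (join A x y) = join M (f i x) (f i y)"
    if "i \<in> I" "x \<in> C i" "y \<in> C i" for i x y
    using f(2)[OF that(1)] that(2,3) by (simp_all add: bhom_def C_def)
  have fC0: "f i (bzero A) = bzero M" "f i (bone A) = bone M" if "i \<in> I" for i
    using f(2)[OF that] by (simp_all add: bhom_def)
  have C0: "bzero A \<in> C i" "bone A \<in> C i" for i by (auto simp: C_def intro: span.intros)
  have hhom: "h \<in> bhom U M"
  proof -
    obtain i where i: "i \<in> I" using dir by (auto simp only: directed_poset_def)
    have "h \<in> extensional (carr U)" by (simp add: h_def)
    moreover have "h x \<in> carr M" "h (neg A x) = neg M (h x)" if x: "x \<in> carr U" for x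
    proof -
      obtain k where k: "k \<in> I" "x \<in> C k" using x CU by auto
      then have "neg A x \<in> C k" by (auto simp: C_def intro: span.neg)
      then show "h x \<in> carr M" "h (neg A x) = neg M (h x)" using k by (simp_all add: h fC)
    qed
    moreover have "h (meet A x y) = meet M (h x) (h y) \<and> h (join A x y) = join M (h x) (h y)"
      if xy: "x \<in> carr U" "y \<in> carr U" for x y
    proof -
      obtain k where k: "k \<in> I" "x \<in> C k" "y \<in> C k" using common[OF xy] by blast
      then have "meet A x y \<in> C k" "join A x y \<in> C k" by (auto simp: C_def intro: span.intros)
      then show ?thesis using k by (simp add: h fC2)
    qed
    moreover have "h (bzero A) = bzero M" "h (bone A) = bone M"
      using i C0 by (simp_all add: h fC0)
    ultimately show ?thesis by (auto simp: bhom_def ops PiE_def)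
  qed
  have hin: "h \<in> bhom U M" "(U, h, M) \<in> Hom BoolP U M"
  proof -
    have "h ` scale U p \<subseteq> scale M p" for p
    proof
      fix y assume "y \<in> h ` scale U p"
      then obtain x i where x: "i \<in> I" "x \<in> scale (sub_F d A gen (K i)) p" "y = h x"
        unfolding U_def scale_Union by blast
      then have "x \<in> C i" using balg_ideal_scale[of "K i" p] by (auto simp: balg_ideal_def C_def)
      then show "y \<in> scale M p" using x f(3)[of i p] h by auto
    qed
    then show "(U, h, M) \<in> Hom BoolP U M" using hhom sU sM by (simp add: Hom_BoolP_iff)
  qed (fact hhom)
  \<comment> \<open>Both sides vanish to the default value off \<open>C i\<close>, so equality of
    arrows reduces to equality on \<open>C i\<close>.\<close>
  have cmp_iff: "(U, g, M) \<cdot>\<^bsub>BoolP\<^esub> incl_arrow (sub_F d A gen (K i)) U = m i \<longleftrightarrow> (\<forall>x\<in>C i. g x = f i x)"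
    if i: "i \<in> I" for g i
  proof -
    have "f i \<in> extensional (C i)" using f(2)[OF i] by (auto simp: bhom_def PiE_def C_def)
    then show ?thesis
      using f(1)[OF i] by (auto simp: incl_arrow_def compose_def C_def fun_eq_iff extensional_def restrict_def)
  qed
  show "\<exists>!k. k \<in> Hom BoolP (sub_F d A gen (\<Union>i\<in>I. K i)) M \<and>
    (\<forall>i\<in>I. k \<cdot>\<^bsub>BoolP\<^esub> incl_arrow (sub_F d A gen (K i)) (sub_F d A gen (\<Union>i\<in>I. K i)) = m i)"
    unfolding U_def[symmetric]
  proof (rule ex1I[of _ "(U, h, M)"])
    show "(U, h, M) \<in> Hom BoolP U M \<and>
        (\<forall>i\<in>I. (U, h, M) \<cdot>\<^bsub>BoolP\<^esub> incl_arrow (sub_F d A gen (K i)) U = m i)"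
      using hin(2) h cmp_iff by (intro conjI ballI iffD2[OF cmp_iff])
    fix k assume k: "k \<in> Hom BoolP U M \<and> (\<forall>i\<in>I. k \<cdot>\<^bsub>BoolP\<^esub> incl_arrow (sub_F d A gen (K i)) U = m i)"
    then obtain g where g: "k = (U, g, M)" "g \<in> bhom U M" by (auto simp: Hom_BoolP_iff)
    have "g = h"
    proof (rule extensionalityI)
      show "g \<in> extensional (carr U)" using g(2) by (auto simp: bhom_def PiE_def)
      show "h \<in> extensional (carr U)" by (simp add: h_def)
      fix x assume "x \<in> carr U"
      then obtain i where i: "i \<in> I" "x \<in> C i" using CU by auto
      then have "g x = f i x" using k g(1) cmp_iff[of i g] by blast
      then show "g x = h x" using h i by simp
    qed
    then show "k = (U, h, M)" using g(1) by simp
  qed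
qed

lemma diagram_sub_F:
  "diagram BoolP I le (\<lambda>i. sub_F d A gen (K i))
     (\<lambda>i j. incl_arrow (sub_F d A gen (K i)) (sub_F d A gen (K j)))"
proof -
  have "span A (gen ` K i) \<subseteq> span A (gen ` K j)" if "i \<in> I" "j \<in> I" "le i j" for i j
    by (intro span_mono image_mono mono that)
  moreover have "sub_F d A gen (K i) \<in> Ob BoolP" if "i \<in> I" for i
    using scaled_boolean_algebra_sub_F[OF closed[OF that]] by (simp add: BoolP_def)
  moreover have "incl_arrow B B = ident BoolP B" for B :: "('u, 'p) scaled"
    by (simp add: BoolP_def incl_arrow_def)
  moreover have "incl_arrow (sub_F d A gen (K i)) (sub_F d A gen (K j))
      \<in> Hom BoolP (sub_F d A gen (K i)) (sub_F d A gen (K j))" if "i \<in> I" "j \<in> I" "le i j" for i j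
    by (intro incl_arrow_in closed mono that)
  ultimately show ?thesis by (simp add: diagram_def incl_arrow_cmp)
qed

end

end

section \<open>Change of index poset\<close>

text \<open>Cocones over the two index sets correspond through the inverse of \<open>g\<close>. This
  allows index sets of other types to be replaced by copies inside the universe
  \<open>'u\<close>.\<close>

lemma colimit_image:
  assumes "inj_on g I"
  shows "colimit C (g ` I) le E e L l \<longleftrightarrow>
    colimit C I (\<lambda>i j. le (g i) (g j)) (\<lambda>i. E (g i)) (\<lambda>i j. e (g i) (g j)) L (\<lambda>i. l (g i))"
    (is "?l \<longleftrightarrow> ?r")
proof -
  have cocone: "cocone C (g ` I) le E e M m \<longleftrightarrow>
      cocone C I (\<lambda>i j. le (g i) (g j)) (\<lambda>i. E (g i)) (\<lambda>i j. e (g i) (g j)) M (\<lambda>i. m (g i))" for M m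
    by (simp add: cocone_def)
  show ?thesis
  proof
    assume l: ?l
    show ?r
      unfolding colimit_def
    proof (intro conjI allI impI)
      show "cocone C I (\<lambda>i j. le (g i) (g j)) (\<lambda>i. E (g i)) (\<lambda>i j. e (g i) (g j)) L (\<lambda>i. l (g i))"
        using l by (simp add: colimit_def cocone)
      fix M m assume m: "cocone C I (\<lambda>i j. le (g i) (g j)) (\<lambda>i. E (g i)) (\<lambda>i j. e (g i) (g j)) M m"
      have m_eq: "m (inv_into I g (g i)) = m i" if "i \<in> I" for i using assms that by simp
      have "cocone C (g ` I) le E e M (\<lambda>i. m (inv_into I g i))"
        using m by (simp add: cocone_def m_eq)
      then have "\<exists>!h. h \<in> Hom C L M \<and> (\<forall>i\<in>g ` I. h \<cdot>\<^bsub>C\<^esub> l i = m (inv_into I g i))"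
        using l unfolding colimit_def by blast
      then show "\<exists>!h. h \<in> Hom C L M \<and> (\<forall>i\<in>I. h \<cdot>\<^bsub>C\<^esub> l (g i) = m i)" by (simp add: m_eq)
    qed
  next
    assume r: ?r
    show ?l
      unfolding colimit_def
    proof (intro conjI allI impI)
      show "cocone C (g ` I) le E e L l" using r by (simp add: colimit_def cocone)
      fix M m assume "cocone C (g ` I) le E e M m"
      then have "\<exists>!h. h \<in> Hom C L M \<and> (\<forall>i\<in>I. h \<cdot>\<^bsub>C\<^esub> l (g i) = m (g i))"
        using r unfolding colimit_def cocone by blast
      then show "\<exists>!h. h \<in> Hom C L M \<and> (\<forall>i\<in>g ` I. h \<cdot>\<^bsub>C\<^esub> l i = m i)" by simp
    qed
  qed
qed

lemma directed_poset_image: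
  assumes "inj_on g I"
  shows "directed_poset (g ` I) le \<longleftrightarrow> directed_poset I (\<lambda>i j. le (g i) (g j))"
  using assms by (simp add: directed_poset_def inj_on_eq_iff)

lemma diagram_image:
  "diagram C (g ` I) le E e \<longleftrightarrow>
     diagram C I (\<lambda>i j. le (g i) (g j)) (\<lambda>i. E (g i)) (\<lambda>i j. e (g i) (g j))"
  by (simp add: diagram_def)

lemma diagram_functor:
  assumes "is_functor C D F" "diagram C I le E e"
  shows "diagram D I le (\<lambda>i. omap F (E i)) (\<lambda>i j. amap F (e i j))"
  unfolding diagram_def
proof (intro conjI ballI impI)
  fix i j k assume ijk: "i \<in> I" "j \<in> I" "k \<in> I" "le i j \<and> le j k"
  then have "e i k = e j k \<cdot>\<^bsub>C\<^esub> e i j" "e i j \<in> Hom C (E i) (E j)" "e j k \<in> Hom C (E j) (E k)"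
    using assms(2) by (simp_all add: diagram_def)
  then show "amap F (e i k) = amap F (e j k) \<cdot>\<^bsub>D\<^esub> amap F (e i j)"
    using assms(1) unfolding is_functor_def by metis
qed (use assms in \<open>auto simp: diagram_def is_functor_def\<close>)

text \<open>Preservation is defined for index sets in \<open>'u\<close> only; an index set that
  embeds into \<open>'u\<close> is replaced by its image there.\<close>

lemma preserves_directed_colimitsD:
  fixes I :: "'i set"
  assumes F: "preserves_directed_colimits TYPE('u) C D F" and size: "|I| \<le>o |UNIV :: 'u set|"
    and dir: "directed_poset I le" and dia: "diagram C I le E e" and col: "colimit C I le E e L l"
  shows "colimit D I le (\<lambda>i. omap F (E i)) (\<lambda>i j. amap F (e i j)) (omap F L) (\<lambda>i. amap F (l i))"
proof -
  obtain f :: "'i \<Rightarrow> 'u" where f: "inj_on f I" using size by (auto simp flip: card_of_ordLeq)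
  define g where "g = inv_into I f"
  have g: "inj_on g (f ` I)" "g ` f ` I = I" using f by (auto simp: g_def inj_on_inv_into)
  note im = colimit_image[OF g(1), unfolded g(2)] directed_poset_image[OF g(1), unfolded g(2)]
    diagram_image[of _ g "f ` I", unfolded g(2)]
  have "colimit D (f ` I) (\<lambda>i j. le (g i) (g j)) (\<lambda>i. omap F (E (g i)))
      (\<lambda>i j. amap F (e (g i) (g j))) (omap F L) (\<lambda>i. amap F (l (g i)))"
    using F dir[unfolded im] dia[unfolded im] col[unfolded im] unfolding preserves_directed_colimits_def
    by blast
  then show ?thesis unfolding im .
qed

section \<open>The algebras two p and the arrows to them\<close>

lemma two_simps [simp]:
  "carr (two p) = {0, 1}" "bzero (two p) = 0" "bone (two p) = 1"
  "meet (two p) x y = (if x = 1 \<and> y = 1 then 1 else 0)"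
  "join (two p) x y = (if x = 1 \<or> y = 1 then 1 else 0)"
  "neg (two p) x = (if x = 1 then 0 else 1)"
  "scale (two p) q = (if q \<le> p then {0, 1} else {0})"
  by (simp_all add: two_def)

lemma ble_two: "ble (two p) x y \<longleftrightarrow> (if x = 1 \<and> y = 1 then 1 else 0) = x"
  by (simp add: ble_def)

lemma boolean_alg_two: "boolean_alg (two p)"
  by unfold_locales auto

lemma balg_ideal_scale_two: "balg_ideal (two p) (scale (two p) q)"
  by (auto simp: balg_ideal_def ble_two split: if_splits)

lemma scaled_boolean_algebra_two: "scaled_boolean_algebra (two p :: ('u::zero_neq_one, 'p::order) scaled)"
proof -
  let ?B = "two p :: ('u, 'p) scaled"
  interpret boolean_alg ?B by (rule boolean_alg_two)
  have scale: "scale ?B q \<subseteq> carr ?B" for q by simp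
  have join: "carr ?B = ideal_gen ?B (\<Union>q. scale ?B q)"
  proof
    show "ideal_gen ?B (\<Union>q. scale ?B q) \<subseteq> carr ?B"
      using scale by (intro ideal_gen_least balg_ideal_carr) blast
    have "carr ?B \<subseteq> (\<Union>q. scale ?B q)" by force
    then show "carr ?B \<subseteq> ideal_gen ?B (\<Union>q. scale ?B q)" using ideal_gen_superset by (rule order.trans)
  qed
  have inter: "scale ?B q \<inter> scale ?B q' = ideal_gen ?B (\<Union>r \<in> {r. q \<le> r \<and> q' \<le> r}. scale ?B r)" for q q'
  \<comment> \<open>If both indices are below \<open>p\<close>, then \<open>r = p\<close> occurs in
    the union. Otherwise no \<open>r \<le> p\<close> is above both, and both sides are the zero
    ideal.\<close>
  proof (cases "q \<le> p \<and> q' \<le> p")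
    case True
    then have eq: "scale ?B q \<inter> scale ?B q' = scale ?B p" by simp
    show ?thesis
      unfolding eq
    proof
      show "scale ?B p \<subseteq> ideal_gen ?B (\<Union>r \<in> {r. q \<le> r \<and> q' \<le> r}. scale ?B r)"
        using True by (intro order.trans[OF _ ideal_gen_superset] UN_upper) simp
      show "ideal_gen ?B (\<Union>r \<in> {r. q \<le> r \<and> q' \<le> r}. scale ?B r) \<subseteq> scale ?B p"
        by (intro ideal_gen_least balg_ideal_scale_two UN_least) simp
    qed
  next
    case False
    then have eq: "scale ?B q \<inter> scale ?B q' = {0}" by auto
    have zero: "balg_ideal ?B {0}" by (auto simp: balg_ideal_def ble_two)
    have "r \<le> p \<Longrightarrow> \<not> (q \<le> r \<and> q' \<le> r)" for r using False by (meson order.trans)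
    then have sub: "(\<Union>r \<in> {r. q \<le> r \<and> q' \<le> r}. scale ?B r) \<subseteq> {0}" by auto
    have "0 \<in> ideal_gen ?B (\<Union>r \<in> {r. q \<le> r \<and> q' \<le> r}. scale ?B r)"
      by (auto simp: ideal_gen_def balg_ideal_def)
    then show ?thesis unfolding eq using ideal_gen_least[OF zero sub] by blast
  qed
  show ?thesis
    unfolding scaled_boolean_algebra_def
    by (intro conjI allI join inter boolean_alg_two balg_ideal_scale_two) simp
qed

lemma atoms_two: "atoms (two p) = {1}"
  by (auto simp: atoms_def ble_two)

lemma atom_norm_two: "atom_norm (two p :: ('u::zero_neq_one, 'p::order) scaled) 1 = p"
  unfolding atom_norm_def by (rule Greatest_equality) (auto split: if_splits)

lemma compact_two: "compact_scaled (two p :: ('u::zero_neq_one, 'p::order) scaled)"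
  by (auto simp: compact_scaled_def scaled_boolean_algebra_two atoms_two has_norm_def
      intro!: exI[of _ p] split: if_splits)

lemma incl_arrow_two_in:
  "p \<le> q \<Longrightarrow> incl_arrow (two p) (two q) \<in> Hom BoolP (two p) (two q :: ('u::zero_neq_one, 'p::order) scaled)"
  by (auto simp: Hom_BoolP_iff incl_arrow_def scaled_boolean_algebra_two bhom_def split: if_splits
      intro: order.trans)

text \<open>The product defining the condensate at \<open>two p\<close> has one factor, for the atom
  \<open>1\<close> of norm \<open>p\<close>. The inclusion \<open>two p\<close> to
  \<open>two q\<close> sends this atom to the atom of \<open>two q\<close>, so the rule for
  projections yields \<open>\<alpha> p q\<close>.\<close>

lemma condensate_two:
  fixes T :: "(('u::zero_neq_one, 'p::order) scaled, ('u, 'p) scaled_arrow, 'o, 'm) ftr"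
  assumes "is_condensate C A \<alpha> T pr"
  shows condensate_two_proj: "pr (two p) 1 \<in> Hom C (omap T (two p)) (A p)"
    and condensate_two_arrow: "p \<le> q \<Longrightarrow>
      pr (two q) 1 \<cdot>\<^bsub>C\<^esub> amap T (incl_arrow (two p) (two q)) = \<alpha> p q \<cdot>\<^bsub>C\<^esub> pr (two p) 1"
proof -
  have "is_product C (atoms (two p)) (\<lambda>u. A (atom_norm (two p :: ('u, 'p) scaled) u)) (omap T (two p)) (pr (two p))"
    using assms compact_two by (auto simp: is_condensate_def)
  then show "pr (two p) 1 \<in> Hom C (omap T (two p)) (A p)"
    by (simp add: is_product_def atoms_two atom_norm_two)
  assume "p \<le> q"
  moreover have "ble (two q) 1 (arrow_fun (incl_arrow (two p) (two q :: ('u, 'p) scaled)) 1)"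
    by (simp add: ble_two arrow_fun_def incl_arrow_def)
  ultimately have "pr (two q) 1 \<cdot>\<^bsub>C\<^esub> amap T (incl_arrow (two p) (two q))
      = \<alpha> (atom_norm (two p :: ('u, 'p) scaled) 1) (atom_norm (two q :: ('u, 'p) scaled) 1) \<cdot>\<^bsub>C\<^esub> pr (two p) 1"
    using assms compact_two[of p] compact_two[of q] incl_arrow_two_in[of p q]
      atoms_two[of p, where ?'a = 'u] atoms_two[of q, where ?'a = 'u]
    unfolding is_condensate_def by (metis singletonI)
  then show "pr (two q) 1 \<cdot>\<^bsub>C\<^esub> amap T (incl_arrow (two p) (two q)) = \<alpha> p q \<cdot>\<^bsub>C\<^esub> pr (two p) 1"
    by (simp add: atom_norm_two)
qed

text \<open>Each defining property of an ideal serves one relation: being a lower set makes the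
  characteristic function antitone, directedness gives the meets, and nonemptiness gives the unit.
  In the last two, \<open>nabla_below_upper_bound\<close> supplies a minimal upper bound in
  \<open>x\<close>.\<close>

lemma F_relations_two:
  fixes x :: "'x::order set"
  assumes pjs: "pseudo_join_semilattice TYPE('x)" and x: "poset_ideal x"
  shows "F_relations (two p :: ('u::zero_neq_one, 'p::order) scaled) (\<lambda>v. if v \<in> x then 1 else 0)"
proof -
  let ?B = "two p :: ('u, 'p) scaled" and ?g = "\<lambda>v. if v \<in> x then 1 else 0 :: 'u"
  have lower: "u \<in> x" if "v \<in> x" "u \<le> v" for u v using x that by (auto simp: poset_ideal_def)
  have join_one: "is_join ?B Y 1" if "1 \<in> Y" "Y \<subseteq> {0, 1}" for Y
    unfolding is_join_def is_sup_in_def using that by (auto simp: ble_two intro!: bexI[of _ 1])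
  have top: "is_join ?B (?g ` S) 1" if "w \<in> S" "w \<in> x" for S w
  proof (rule join_one)
    show "1 \<in> ?g ` S" using that by (intro image_eqI[of _ _ w]) auto
  qed auto
  have bot: "is_join ?B (?g ` S) 0" if "S \<inter> x = {}" for S
    using that by (auto simp: is_join_def is_sup_in_def ble_two)
  have "is_join ?B (?g ` nabla {u, v}) (meet ?B (?g u) (?g v))" for u v
  proof (cases "u \<in> x \<and> v \<in> x")
    case True
    then obtain z where z: "z \<in> x" "u \<le> z" "v \<le> z" using x unfolding poset_ideal_def by metis
    then have "z \<in> upper_bounds {u, v}" by (auto simp: upper_bounds_def)
    then obtain w where w: "w \<in> nabla {u, v}" "w \<le> z"
      using nabla_below_upper_bound[OF pjs, of "{u, v}"] by blast
    then have "w \<in> x" using lower z(1) by blast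
    then show ?thesis using top[OF w(1)] True by simp
  next
    case False
    then have "nabla {u, v} \<inter> x = {}" using lower nabla_upper by blast
    then show ?thesis using bot[of "nabla {u, v}"] False by auto
  qed
  moreover have "is_join ?B (?g ` {u. \<forall>v. v \<le> u \<longrightarrow> v = u}) (bone ?B)"
  proof -
    obtain z where z: "z \<in> x" using x by (auto simp: poset_ideal_def)
    have "z \<in> upper_bounds {}" by (simp add: upper_bounds_def)
    then obtain w where w: "w \<in> nabla {}" "w \<le> z"
      using nabla_below_upper_bound[OF pjs, of "{}"] by blast
    then show ?thesis using top[OF _ lower[OF z w(2)]] by (simp add: nabla_empty)
  qed
  moreover have "ble ?B (?g v) (?g u)" if "u \<le> v" for u v
    using that lower by (auto simp: ble_two)
  ultimately show ?thesis unfolding F_relations_def by auto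
qed

section \<open>The universal property\<close>

text \<open>The universal property in \<open>is_F\<close> only concerns plain records; extended ones are truncated.\<close>

lemma is_F_universal:
  fixes B :: "('u, 'z) balg_scheme" and A :: "('u, 'p::order) scaled"
  assumes F: "is_F d A gen" and B: "boolean_alg B" "F_relations B g"
  shows "\<exists>!h. h \<in> bhom A B \<and> (\<forall>u. h (gen u) = g u)"
proof -
  define B' where "B' = \<lparr>carr = carr B, meet = meet B, join = join B, neg = neg B, bzero = bzero B, bone = bone B\<rparr>"
  have B'_simps: "carr B' = carr B" "meet B' = meet B" "join B' = join B" "neg B' = neg B"
    "bzero B' = bzero B" "bone B' = bone B" "ble B' = ble B"
    by (simp_all add: B'_def ble_def fun_eq_iff)
  have "boolean_alg B'" by (rule boolean_alg_transfer[OF B(1)]) (simp_all only: B'_simps)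
  moreover have "F_relations B' g"
    using B(2) unfolding F_relations_def is_join_def B'_simps .
  ultimately have "\<exists>!h. h \<in> bhom A B' \<and> (\<forall>u. h (gen u) = g u)"
    using F unfolding is_F_def by blast
  moreover have "bhom A B' = bhom A B" unfolding bhom_def B'_simps ..
  ultimately show ?thesis by simp
qed

lemma is_F_hom:
  fixes B :: "('u, 'z) balg_scheme" and A :: "('u, 'p::order) scaled"
  assumes "is_F d A gen" "boolean_alg B" "F_relations B g"
  obtains h where "h \<in> bhom A B" "\<And>u. h (gen u) = g u"
  using ex1_implies_ex[OF is_F_universal[OF assms]] by metis

lemma is_F_hom_unique:
  fixes B :: "('u, 'z) balg_scheme" and A :: "('u, 'p::order) scaled"
  assumes "is_F d A gen" "boolean_alg B" "F_relations B g"
    and "h \<in> bhom A B" "\<And>u. h (gen u) = g u" and "h' \<in> bhom A B" "\<And>u. h' (gen u) = g u"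
  shows "h = h'"
  using ex1E[OF is_F_universal[OF assms(1-3)], of "h = h'"] assms(4-7) by metis

text \<open>A principal ideal induces a homomorphism to a two-element algebra, which separates zero
  from one. The values \<open>undefined\<close> only name some element of the posets.\<close>

lemma is_F_nontrivial:
  fixes A :: "('u::zero_neq_one, 'p::order) scaled" and d :: "'x::order \<Rightarrow> 'p"
  assumes F: "is_F d A gen" and pjs: "pseudo_join_semilattice TYPE('x)"
  shows "bzero A \<noteq> bone A"
proof -
  let ?B = "two undefined :: ('u, 'p) scaled"
  have "poset_ideal {v. v \<le> (undefined :: 'x)}"
    unfolding poset_ideal_def by (auto intro: order.trans)
  then obtain h where "h \<in> bhom A ?B"
    by (rule is_F_hom[OF F boolean_alg_two F_relations_two[OF pjs]])
  then have "h (bzero A) = 0" "h (bone A) = 1" by (auto simp: bhom_def)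
  then show ?thesis by auto
qed

lemma covering_algebra_is_F:
  fixes A :: "('u::zero_neq_one, 'p::order) scaled" and d :: "'x::order \<Rightarrow> 'p"
  assumes F: "is_F d A gen" and "norm_covering d"
  shows "covering_algebra d A gen"
proof (rule covering_algebra.intro)
  show pjs: "pseudo_join_semilattice TYPE('x)" and "mono d"
    using assms(2) by (simp_all add: norm_covering_def)
  show "bzero A \<noteq> bone A" using is_F_nontrivial[OF F pjs] .
qed (use F in \<open>simp_all add: is_F_def\<close>)

text \<open>The universal property maps \<open>A\<close> into the subalgebra spanned by the
  generators. Viewed as an endomorphism of \<open>A\<close>, this map fixes the generators, so by
  uniqueness it is the identity.\<close>

lemma span_generators:
  fixes A :: "('u::zero_neq_one, 'p::order) scaled" and d :: "'x::order \<Rightarrow> 'p"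
  assumes F: "is_F d A gen" and cov: "norm_covering d"
  shows "span A (range gen) = carr A"
proof -
  interpret covering_algebra d A gen by (rule covering_algebra_is_F[OF F cov])
  let ?B = "sub_F d A gen UNIV"
  note sub = A.span_subset[OF gen_carr[of UNIV]]
  have gens: "gen u \<in> span A (range gen)" for u by (auto intro: span.gen)
  \<comment> \<open>A least upper bound in \<open>A\<close> that lies in the subalgebra remains
    least there, so the relations pass to the subalgebra.\<close>
  have join: "is_join ?B S z" if "is_join A S z" "z \<in> span A (range gen)" for S z
    using that sub by (auto simp: is_join_def is_sup_in_def)
  have "F_relations ?B gen"
    using rel gens by (auto simp: F_relations_def intro!: join span.meet span.one)
  then obtain h where h: "h \<in> bhom A ?B" "\<And>u. h (gen u) = gen u"
    using is_F_hom[OF F boolean_alg_sub_F[OF A(1) gen_carr]] by metis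
  then have "h \<in> bhom A A" using sub by (auto simp: bhom_def PiE_def Pi_def)
  moreover have "(\<lambda>x\<in>carr A. x) \<in> bhom A A"
    by (auto simp: bhom_def A.meet_in A.join_in A.neg_in A.zero_in A.one_in)
  moreover have "(\<lambda>x\<in>carr A. x) (gen u) = gen u" for u using gen_carr by auto
  ultimately have "h = (\<lambda>x\<in>carr A. x)" using is_F_hom_unique[OF F A(1) rel] h(2) by metis
  then have "x \<in> span A (range gen)" if "x \<in> carr A" for x
    using h(1) that by (auto simp: bhom_def PiE_def Pi_def)
  then show ?thesis using sub by blast
qed

text \<open>Places \<open>F(X)\<close> itself in the family of subalgebras, so that it can be the
  vertex of their colimits.\<close>

lemma sub_F_UNIV:
  fixes A :: "('u::zero_neq_one, 'p::order) scaled" and d :: "'x::order \<Rightarrow> 'p"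
  assumes F: "is_F d A gen" and cov: "norm_covering d"
  shows "sub_F d A gen UNIV = A"
proof -
  have "scale A = (\<lambda>p. ideal_gen (A\<lparr>carr := carr A\<rparr>) {gen u | u. u \<in> UNIV \<and> p \<le> d u})"
    using F by (auto simp: is_F_def)
  then show ?thesis unfolding sub_F_def span_generators[OF assms] by simp
qed

section \<open>The arrows attached to sharp ideals\<close>

lemma sharp_ideal_norm:
  assumes "x \<in> sharp_ideals d" "v \<in> x"
  shows "d v \<le> ideal_norm d x"
proof -
  obtain m where m: "m \<in> d ` x" "\<forall>p \<in> d ` x. p \<le> m" using assms(1) by (auto simp: sharp_ideals_def)
  then have "ideal_norm d x = m" unfolding ideal_norm_def by (intro Greatest_equality) auto
  then show ?thesis using m(2) assms(2) by blast
qed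

text \<open>The universal property gives the homomorphism and its uniqueness. For \<open>q\<close>
  not below the norm of \<open>x\<close>, no \<open>u\<close> with \<open>q \<le> d u\<close> lies
  in \<open>x\<close>, so the generators of the ideal at \<open>q\<close>, and hence the ideal, are
  sent to zero.\<close>

lemma pi_arrow:
  fixes A :: "('u::zero_neq_one, 'p::order) scaled" and d :: "'x::order \<Rightarrow> 'p"
  assumes F: "is_F d A gen" and cov: "norm_covering d" and x: "x \<in> sharp_ideals d"
  shows pi_arrow_in: "pi_arrow d A gen x \<in> Hom BoolP A (two (ideal_norm d x))"
    and pi_arrow_gen: "arrow_fun (pi_arrow d A gen x) (gen v) = (if v \<in> x then 1 else 0)"
proof -
  interpret covering_algebra d A gen by (rule covering_algebra_is_F[OF F cov])
  let ?p = "ideal_norm d x"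
  let ?P = "\<lambda>m. m \<in> Hom BoolP A (two ?p) \<and> (\<forall>v. arrow_fun m (gen v) = (if v \<in> x then 1 else 0))"
  have "poset_ideal x" using x by (simp add: sharp_ideals_def)
  note rel_two = F_relations_two[OF pjs this, where p = ?p]
  obtain h where h: "h \<in> bhom A (two ?p :: ('u, 'p) scaled)" "\<And>u. h (gen u) = (if u \<in> x then 1 else 0)"
    using is_F_hom[OF F boolean_alg_two rel_two] by metis
  have sA: "scaled_boolean_algebra A"
    using scaled_boolean_algebra_sub_F[of UNIV] unfolding sub_F_UNIV[OF F cov] by (simp add: nabla_closed_def)
  have "h ` scale A q \<subseteq> scale (two ?p :: ('u, 'p) scaled) q" for q
  proof (cases "q \<le> ?p")
    case True
    then show ?thesis using h(1) scale_subset_carr[OF sA] by (auto simp: bhom_def PiE_def Pi_def)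
  next
    case False
    have gens: "{gen u | u. q \<le> d u} \<subseteq> carr A" using gen_carr by blast
    have "h y = 0" if "y \<in> ideal_gen A {gen u | u. q \<le> d u}" for y
      using that gens
    proof (induction rule: A.ideal_gen_induct)
      case zero
      then show ?case using h(1) by (simp add: bhom_def)
    next
      case (gen s)
      then obtain u where u: "s = gen u" "q \<le> d u" by blast
      then have "u \<notin> x" using sharp_ideal_norm[OF x] False order.trans by blast
      then show ?case using u(1) h(2) by simp
    next
      case (join y z)
      then show ?case using h(1) by (simp add: bhom_def)
    next
      case (lower y z)
      then have "h (meet A z y) = meet (two ?p :: ('u, 'p) scaled) (h z) (h y)"
        using h(1) by (simp add: bhom_def)
      then show ?case using lower by (simp add: ble_def split: if_splits)
    qed
    moreover have "scale A q = ideal_gen A {gen u | u. q \<le> d u}" using F by (simp add: is_F_def)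
    ultimately show ?thesis using False by auto
  qed
  then have "?P (A, h, two ?p)"
    using h sA by (simp add: Hom_BoolP_iff scaled_boolean_algebra_two arrow_fun_def)
  moreover have "m = (A, h, two ?p)" if m: "?P m" for m
  proof -
    obtain f where f: "m = (A, f, two ?p)" "f \<in> bhom A (two ?p)" using m by (auto simp: Hom_BoolP_iff)
    have "f (gen u) = (if u \<in> x then 1 else 0)" for u using m f(1) by (simp add: arrow_fun_def)
    then have "f = h" using is_F_hom_unique[OF F boolean_alg_two rel_two f(2)] h by metis
    then show ?thesis using f(1) by simp
  qed
  ultimately have "?P (pi_arrow d A gen x)" unfolding pi_arrow_def by (rule theI)
  then show "pi_arrow d A gen x \<in> Hom BoolP A (two ?p)"
    "arrow_fun (pi_arrow d A gen x) (gen v) = (if v \<in> x then 1 else 0)" by simp_all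
qed

lemma pi_arrow_restrict:
  fixes A :: "('u::zero_neq_one, 'p::order) scaled" and d :: "'x::order \<Rightarrow> 'p"
  assumes F: "is_F d A gen" and cov: "norm_covering d"
    and x: "x \<in> sharp_ideals d" and y: "y \<in> sharp_ideals d"
    and norm: "ideal_norm d x \<le> ideal_norm d y" and sub: "x \<subseteq> y" "Z \<inter> y \<subseteq> x"
    and Z: "nabla_closed Z"
  defines "\<iota> \<equiv> incl_arrow (sub_F d A gen Z) A"
  shows "pi_arrow d A gen y \<cdot>\<^bsub>BoolP\<^esub> \<iota>
    = incl_arrow (two (ideal_norm d x)) (two (ideal_norm d y)) \<cdot>\<^bsub>BoolP\<^esub> (pi_arrow d A gen x \<cdot>\<^bsub>BoolP\<^esub> \<iota>)"
proof -
  interpret covering_algebra d A gen by (rule covering_algebra_is_F[OF F cov])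
  let ?B = "sub_F d A gen Z" and ?p = "ideal_norm d x" and ?q = "ideal_norm d y"
  have \<iota>: "\<iota> \<in> Hom BoolP ?B A"
    using incl_arrow_in[OF Z, of UNIV] unfolding \<iota>_def sub_F_UNIV[OF F cov] by (simp add: nabla_closed_def)
  obtain f where f: "pi_arrow d A gen x = (A, f, two ?p)" "\<And>v. f (gen v) = (if v \<in> x then 1 else 0)"
    using pi_arrow[OF F cov x] by (auto simp: Hom_BoolP_iff arrow_fun_def)
  obtain g where g: "pi_arrow d A gen y = (A, g, two ?q)" "\<And>v. g (gen v) = (if v \<in> y then 1 else 0)"
    using pi_arrow[OF F cov y] by (auto simp: Hom_BoolP_iff arrow_fun_def)
  have 1: "pi_arrow d A gen y \<cdot>\<^bsub>BoolP\<^esub> \<iota> \<in> Hom BoolP ?B (two ?q)"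
    using cmp_BoolP_in[OF \<iota> pi_arrow_in[OF F cov y]] .
  have 2: "incl_arrow (two ?p) (two ?q) \<cdot>\<^bsub>BoolP\<^esub> (pi_arrow d A gen x \<cdot>\<^bsub>BoolP\<^esub> \<iota>) \<in> Hom BoolP ?B (two ?q)"
    using cmp_BoolP_in[OF cmp_BoolP_in[OF \<iota> pi_arrow_in[OF F cov x]] incl_arrow_two_in[OF norm]] .
  obtain g' where g': "pi_arrow d A gen y \<cdot>\<^bsub>BoolP\<^esub> \<iota> = (?B, g', two ?q)" "g' \<in> bhom ?B (two ?q)"
    using 1 by (auto simp: Hom_BoolP_iff)
  obtain f' where f': "incl_arrow (two ?p) (two ?q) \<cdot>\<^bsub>BoolP\<^esub> (pi_arrow d A gen x \<cdot>\<^bsub>BoolP\<^esub> \<iota>) = (?B, f', two ?q)"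
    "f' \<in> bhom ?B (two ?q)"
    using 2 by (auto simp: Hom_BoolP_iff)
  have "g' = f'"
  proof (rule bhom_span_eqI[OF A(1) gen_carr[of Z] _ _ _ _ _ _ g'(2) f'(2)])
    fix a assume "a \<in> gen ` Z"
    then obtain v where v: "v \<in> Z" "a = gen v" by blast
    have carr: "a \<in> span A (gen ` Z)" using v by (auto intro: span.gen)
    have "g' a = g a"
      using g'(1) carr by (auto simp: \<iota>_def incl_arrow_def g(1) compose_def)
    moreover have "f' a = f a"
      using f'(1) carr f(2) v(2) by (auto simp: \<iota>_def incl_arrow_def f(1) compose_def)
    moreover have "v \<in> x \<longleftrightarrow> v \<in> y" using sub v(1) by blast
    ultimately show "g' a = f' a" using f(2) g(2) v(2) by simp
  qed simp_all
  then show ?thesis using g'(1) f'(1) by simp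
qed

section \<open>Factorization through small subalgebras\<close>

definition cmp_ftr :: "('o2, 'm2, 'o3, 'm3) ftr \<Rightarrow> ('o1, 'm1, 'o2, 'm2) ftr \<Rightarrow> ('o1, 'm1, 'o3, 'm3) ftr"
  where "cmp_ftr G F = \<lparr>omap = (\<lambda>a. omap G (omap F a)), amap = (\<lambda>f. amap G (amap F f))\<rparr>"

lemma functor_in: "is_functor C D F \<Longrightarrow> f \<in> Hom C a b \<Longrightarrow> amap F f \<in> Hom D (omap F a) (omap F b)"
  unfolding is_functor_def by metis

lemma functor_cmp:
  "is_functor C D F \<Longrightarrow> f \<in> Hom C a b \<Longrightarrow> g \<in> Hom C b c \<Longrightarrow>
    amap F (g \<cdot>\<^bsub>C\<^esub> f) = amap F g \<cdot>\<^bsub>D\<^esub> amap F f"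
  unfolding is_functor_def by metis

lemma is_functor_cmp:
  assumes "is_functor C D F" "is_functor D E G"
  shows "is_functor C E (cmp_ftr G F)"
  unfolding is_functor_def cmp_ftr_def ftr.simps
proof (intro conjI ballI allI)
  fix a b c f g assume fg: "f \<in> Hom C a b" "g \<in> Hom C b c"
  then have "amap F (g \<cdot>\<^bsub>C\<^esub> f) = amap F g \<cdot>\<^bsub>D\<^esub> amap F f" "amap F f \<in> Hom D (omap F a) (omap F b)"
    "amap F g \<in> Hom D (omap F b) (omap F c)"
    using assms(1) unfolding is_functor_def by metis+
  then show "amap G (amap F (g \<cdot>\<^bsub>C\<^esub> f)) = amap G (amap F g) \<cdot>\<^bsub>E\<^esub> amap G (amap F f)"
    using assms(2) unfolding is_functor_def by metis
qed (use assms in \<open>simp_all add: is_functor_def\<close>)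

lemma preserves_directed_colimits_cmp:
  assumes "is_functor C D F" "preserves_directed_colimits TYPE('u) C D F"
    "preserves_directed_colimits TYPE('u) D E G"
  shows "preserves_directed_colimits TYPE('u) C E (cmp_ftr G F)"
  unfolding preserves_directed_colimits_def cmp_ftr_def ftr.simps
proof (intro allI impI, elim conjE)
  fix I :: "'u set" and le B e L l
  assume I: "directed_poset I le" "diagram C I le B e" "colimit C I le B e L l"
  have "colimit D I le (\<lambda>i. omap F (B i)) (\<lambda>i j. amap F (e i j)) (omap F L) (\<lambda>i. amap F (l i))"
    using assms(2) I unfolding preserves_directed_colimits_def by metis
  with diagram_functor[OF assms(1) I(2)]
  show "colimit E I le (\<lambda>i. omap G (omap F (B i))) (\<lambda>i j. amap G (amap F (e i j)))
     (omap G (omap F L)) (\<lambda>i. amap G (amap F (l i)))"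
    using assms(3) I(1) unfolding preserves_directed_colimits_def by metis
qed

text \<open>Weak presentability is applied to the diagram of subalgebras over closures of small
  sets, with \<open>\<Omega>\<close> a copy of the whole of \<open>X\<close> inside
  \<open>'u\<close>.\<close>

lemma weakly_presented_factor:
  fixes lam :: "'l rel" and d :: "'x::order \<Rightarrow> 'p::order" and A :: "('u::zero_neq_one, 'p) scaled"
  assumes size: "|UNIV :: 'x set set| \<le>o |UNIV :: 'u set|"
    and lam: "Card_order lam" "infinite (Field lam)"
    and supp: "lam =o natLeq \<longrightarrow> supported TYPE('x)"
    and F: "is_F d A gen" and cov: "norm_covering d"
    and G: "is_functor BoolP C G" "preserves_directed_colimits TYPE('u) BoolP C G"
    and s: "weakly_presented TYPE('u) lam C s" and f: "f \<in> Hom C s (omap G A)"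
  shows "\<exists>Z g. nabla_closed Z \<and> |Z| <o lam \<and> g \<in> Hom C s (omap G (sub_F d A gen Z)) \<and>
    f = amap G (incl_arrow (sub_F d A gen Z) A) \<cdot>\<^bsub>C\<^esub> g"
proof -
  interpret covering_algebra d A gen by (rule covering_algebra_is_F[OF F cov])
  \<comment> \<open>The power set is embedded, and not only \<open>X\<close>, because the colimits
    are indexed by families of subsets. Singletons then give the embedding \<open>e\<close> of
    \<open>X\<close>.\<close>
  obtain j :: "'x set \<Rightarrow> 'u" where j: "inj j" using size by (auto simp flip: card_of_ordLeq)
  define e where "e x = j {x}" for x
  have e: "inj e" using j by (auto simp: e_def inj_on_def)
  define \<Omega> where "\<Omega> = range e"
  define I where "I = small_subsets lam \<Omega>"
  define K where "K Z = nabla_closure (e -` Z)" for Z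
  define B where "B Z = sub_F d A gen (K Z)" for Z
  have dirI: "directed_poset I (\<subseteq>)" unfolding I_def by (rule directed_small_subsets[OF lam])
  have closed: "nabla_closed (K Z)" for Z unfolding K_def by (rule nabla_closed_closure)
  have mono: "K Z \<subseteq> K W" if "Z \<subseteq> W" for Z W
    unfolding K_def using that by (intro nabla_closure_mono vimage_mono)
  \<comment> \<open>One statement serves twice: \<open>J = I\<close> yields the colimit with vertex
    \<open>omap G A\<close>, and a general \<open>J\<close> yields continuity, since suprema in
    \<open>I\<close> are unions.\<close>
  have col: "colimit C J (\<subseteq>) (\<lambda>Z. omap G (B Z)) (\<lambda>Z W. amap G (incl_arrow (B Z) (B W)))
      (omap G (B (\<Union>J))) (\<lambda>Z. amap G (incl_arrow (B Z) (B (\<Union>J))))"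
    if J: "J \<subseteq> I" "directed_poset J (\<subseteq>)" for J
  proof -
    \<comment> \<open>Members of \<open>J\<close> lie in the range of \<open>e\<close>, so they are
      recovered from their preimages.\<close>
    have "inj_on (\<lambda>Z. j (e -` Z)) J"
    proof (rule inj_onI)
      fix Z W assume "Z \<in> J" "W \<in> J" "j (e -` Z) = j (e -` W)"
      moreover from this have "Z \<subseteq> range e" "W \<subseteq> range e"
        using J(1) by (auto simp: I_def small_subsets_def \<Omega>_def)
      ultimately show "Z = W" using j by (metis inj_eq image_vimage_eq inf.absorb1)
    qed
    then have size: "|J| \<le>o |UNIV :: 'u set|" using card_of_ordLeq by blast
    have "K (\<Union>J) = (\<Union>Z\<in>J. K Z)"
      unfolding K_def vimage_Union using nabla_closure_directed_Union[OF J(2)] by (metis vimage_mono)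
    then show ?thesis
      unfolding B_def
      using preserves_directed_colimitsD[OF G(2) size J(2) diagram_sub_F colimit_sub_F, OF J(2) closed mono J(2) closed mono]
      by simp
  qed
  have UnI: "\<Union>I = \<Omega>" unfolding I_def by (rule Union_small_subsets[OF lam])
  have "K \<Omega> = UNIV" using subset_nabla_closure[of "e -` \<Omega>"] by (auto simp: K_def \<Omega>_def)
  then have B\<Omega>: "B \<Omega> = A" by (simp add: B_def sub_F_UNIV[OF F cov])
  have colI: "colimit C I (\<subseteq>) (\<lambda>Z. omap G (B Z)) (\<lambda>Z W. amap G (incl_arrow (B Z) (B W)))
      (omap G A) (\<lambda>Z. amap G (incl_arrow (B Z) A))"
    using col[OF order_refl dirI] unfolding UnI B\<Omega> .
  have "diagram BoolP I (\<subseteq>) B (\<lambda>Z W. incl_arrow (B Z) (B W))"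
    unfolding B_def by (rule diagram_sub_F[OF dirI closed mono])
  from diagram_functor[OF G(1) this]
  have cont: "continuous_diagram C I (\<subseteq>) (\<lambda>Z. omap G (B Z)) (\<lambda>Z W. amap G (incl_arrow (B Z) (B W)))"
    unfolding continuous_diagram_def using col sup_in_small_subsets unfolding I_def by blast
  have "\<exists>Z\<in>I. \<exists>g\<in>Hom C s (omap G (B Z)). f = amap G (incl_arrow (B Z) A) \<cdot>\<^bsub>C\<^esub> g"
    unfolding I_def
    by (rule s[unfolded weakly_presented_def, THEN conjunct2, rule_format,
          OF conjI[OF cont[unfolded I_def] colI[unfolded I_def]] f])
  then obtain Z g where Z: "Z \<in> I" "g \<in> Hom C s (omap G (B Z))"
    "f = amap G (incl_arrow (B Z) A) \<cdot>\<^bsub>C\<^esub> g"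
    by (elim bexE)
  have "|Z| <o lam" using Z(1) by (simp add: I_def small_subsets_def)
  moreover have "|e -` Z| \<le>o |Z|"
    using e by (auto simp flip: card_of_ordLeq intro!: exI[of _ e] intro: inj_on_subset)
  ultimately have "|e -` Z| <o lam" by (rule ordLeq_ordLess_trans[rotated])
  then have "|K Z| <o lam"
    unfolding K_def by (rule card_of_nabla_closure_ordLess[OF pjs lam supp])
  then show ?thesis using Z(2,3) closed unfolding B_def by blast
qed

section \<open>The Armature Lemma\<close>

text \<open>The factor \<open>pr (two (ideal_norm d x)) 1\<close> in \<open>\<rho>\<close> makes
  explicit the identification of the condensate at \<open>two p\<close> with \<open>A p\<close>. The
  bound \<open>size\<close> places all families of subsets of \<open>X\<close> within the chosen
  universe.\<close>

theorem mainTheorem2: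
  fixes lam :: "'l rel"
    and d :: "'x::order \<Rightarrow> 'p::order"
    and XX :: "'x set set"
    and CA :: "('oa, 'ma) cat"
    and CS :: "('os, 'ms) cat"
    and \<Phi> :: "('oa, 'ma, 'os, 'ms) ftr"
    and A :: "'p \<Rightarrow> 'oa"
    and \<alpha> :: "'p \<Rightarrow> 'p \<Rightarrow> 'ma"
    and FX :: "('u::zero_neq_one, 'p) scaled"
    and gen :: "'x \<Rightarrow> 'u"
    and T :: "(('u, 'p) scaled, ('u, 'p) scaled_arrow, 'oa, 'ma) ftr"
    and pr :: "('u, 'p) scaled \<Rightarrow> 'u \<Rightarrow> 'ma"
    and S :: 'os
    and \<chi> :: 'ms
    and Sx :: "'x set \<Rightarrow> 'os"
    and \<phi> :: "'x set \<Rightarrow> 'ms"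
    and \<phi>\<phi> :: "'x set \<Rightarrow> 'x set \<Rightarrow> 'ms"
    and \<rho> :: "'x set \<Rightarrow> 'ms"
  assumes size: "|UNIV :: 'x set set| \<le>o |UNIV :: 'u set|"
    and lam: "Card_order lam" "infinite (Field lam)"
    and lifter: "lifter lam d XX"
    and CA: "is_category CA"
    and CS: "is_category CS"
    and \<Phi>: "is_functor CA CS \<Phi>"
    and CA_colimits: "has_directed_colimits TYPE('u) CA"
    and CA_products: "has_binary_products CA"
    and \<Phi>_colimits: "preserves_directed_colimits TYPE('u) CA CS \<Phi>"
    and A: "diagram CA UNIV (\<le>) A \<alpha>"
    and FX: "is_F d FX gen"
    and T: "is_condensate CA A \<alpha> T pr"
    and S: "S \<in> Ob CS"
    and \<chi>: "\<chi> \<in> Hom CS S (omap \<Phi> (omap T FX))"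
    and Sx: "diagram (slice CS S) XX (\<subseteq>) (\<lambda>x. (Sx x, \<phi> x))
               (\<lambda>x y. ((Sx x, \<phi> x), \<phi>\<phi> x y, (Sx y, \<phi> y)))"
    and Sx_presented: "\<And>x. x \<in> nonmax d XX \<Longrightarrow> weakly_presented TYPE('u) lam CS (Sx x)"
    and \<rho>: "\<And>x. x \<in> XX \<Longrightarrow>
               \<rho> x = amap \<Phi> (pr (two (ideal_norm d x)) 1 \<cdot>\<^bsub>CA\<^esub> amap T (pi_arrow d FX gen x)) \<cdot>\<^bsub>CS\<^esub> \<chi>"
  shows "\<exists>\<sigma>. isotone_section d XX \<sigma> \<and>
             nat_trans CS UNIV (\<le>)
               (\<lambda>p. Sx (\<sigma> p)) (\<lambda>p q. \<phi>\<phi> (\<sigma> p) (\<sigma> q))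
               (\<lambda>p. omap \<Phi> (A p)) (\<lambda>p q. amap \<Phi> (\<alpha> p q))
               (\<lambda>p. \<rho> (\<sigma> p) \<cdot>\<^bsub>CS\<^esub> \<phi> (\<sigma> p))"
proof -
  interpret CA: is_category CA by (fact CA)
  interpret CS: is_category CS by (fact CS)
  have cov: "norm_covering d" and sharp: "XX \<subseteq> sharp_ideals d"
    and supp: "lam =o natLeq \<longrightarrow> supported TYPE('x)"
    and lift: "\<And>S. S ` nonmax d XX \<subseteq> small_subsets lam UNIV \<Longrightarrow>
      \<exists>\<sigma>. isotone_section d XX \<sigma> \<and> (\<forall>a b. a < b \<longrightarrow> S (\<sigma> a) \<inter> \<sigma> b \<subseteq> \<sigma> a)"
    using lifter unfolding lifter_def by simp_all
  interpret FX: covering_algebra d FX gen by (rule covering_algebra_is_F[OF FX cov])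
  have T_functor: "is_functor BoolP CA T" "preserves_directed_colimits TYPE('u) BoolP CA T"
    using T by (simp_all add: is_condensate_def)
  \<comment> \<open>The factorization lemma is applied to the composite of the condensate functor
    with \<open>\<Phi>\<close>, which again preserves directed colimits.\<close>
  define G where "G = cmp_ftr \<Phi> T"
  have G: "is_functor BoolP CS G" "preserves_directed_colimits TYPE('u) BoolP CS G"
    unfolding G_def
    by (rule is_functor_cmp[OF T_functor(1) \<Phi>], rule preserves_directed_colimits_cmp[OF T_functor \<Phi>_colimits])
  have G_simps: "omap G B = omap \<Phi> (omap T B)" "amap G f = amap \<Phi> (amap T f)" for B f
    by (simp_all add: G_def cmp_ftr_def)

  have \<phi>_in: "\<phi> x \<in> Hom CS (Sx x) S" if "x \<in> XX" for x
    using Sx that by (auto simp: diagram_def slice_def)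
  have \<phi>\<phi>_id: "\<phi>\<phi> x x = ident CS (Sx x)" if "x \<in> XX" for x
    using Sx that by (auto simp: diagram_def slice_def)
  have \<phi>\<phi>: "\<phi>\<phi> x y \<in> Hom CS (Sx x) (Sx y)" "\<phi> y \<cdot>\<^bsub>CS\<^esub> \<phi>\<phi> x y = \<phi> x"
    if "x \<in> XX" "y \<in> XX" "x \<subseteq> y" for x y
  proof -
    have "((Sx x, \<phi> x), \<phi>\<phi> x y, (Sx y, \<phi> y)) \<in> Hom (slice CS S) (Sx x, \<phi> x) (Sx y, \<phi> y)"
      by (rule Sx[unfolded diagram_def, THEN conjunct2, THEN conjunct1, rule_format, OF that])
    then show "\<phi>\<phi> x y \<in> Hom CS (Sx x) (Sx y)" "\<phi> y \<cdot>\<^bsub>CS\<^esub> \<phi>\<phi> x y = \<phi> x"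
      by (simp_all add: Hom_def slice_def)
  qed
  have \<phi>\<phi>_cmp: "\<phi>\<phi> x z = \<phi>\<phi> y z \<cdot>\<^bsub>CS\<^esub> \<phi>\<phi> x y"
    if "x \<in> XX" "y \<in> XX" "z \<in> XX" "x \<subseteq> y" "y \<subseteq> z" for x y z
  proof -
    have "((Sx x, \<phi> x), \<phi>\<phi> x z, (Sx z, \<phi> z)) =
        ((Sx y, \<phi> y), \<phi>\<phi> y z, (Sx z, \<phi> z)) \<cdot>\<^bsub>slice CS S\<^esub> ((Sx x, \<phi> x), \<phi>\<phi> x y, (Sx y, \<phi> y))"
      by (rule Sx[unfolded diagram_def, THEN conjunct2, THEN conjunct2, rule_format, OF that(1-3)])
        (use that(4,5) in simp)
    then show ?thesis by (simp add: slice_def)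
  qed

  define \<pi> where "\<pi> x = pr (two (ideal_norm d x)) 1 \<cdot>\<^bsub>CA\<^esub> amap T (pi_arrow d FX gen x)" for x
  have \<pi>_in: "\<pi> x \<in> Hom CA (omap T FX) (A (ideal_norm d x))" if "x \<in> XX" for x
  proof -
    have "x \<in> sharp_ideals d" using that sharp by (rule subsetD[rotated])
    from functor_in[OF T_functor(1) pi_arrow_in[OF FX cov this]] condensate_two_proj[OF T]
    show ?thesis unfolding \<pi>_def by (rule CA.cmp_in)
  qed
  have \<rho>_eq: "\<rho> x = amap \<Phi> (\<pi> x) \<cdot>\<^bsub>CS\<^esub> \<chi>" if "x \<in> XX" for x using \<rho>[OF that] by (simp add: \<pi>_def)
  have \<Phi>\<pi>_in: "amap \<Phi> (\<pi> x) \<in> Hom CS (omap \<Phi> (omap T FX)) (omap \<Phi> (A (ideal_norm d x)))" if "x \<in> XX" for x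
    by (rule functor_in[OF \<Phi> \<pi>_in[OF that]])
  have \<rho>_in: "\<rho> x \<in> Hom CS S (omap \<Phi> (A (ideal_norm d x)))" if "x \<in> XX" for x
    unfolding \<rho>_eq[OF that] by (rule CS.cmp_in[OF \<chi> \<Phi>\<pi>_in[OF that]])

  have "\<exists>Z g. nabla_closed Z \<and> |Z| <o lam \<and> g \<in> Hom CS (Sx x) (omap G (sub_F d FX gen Z)) \<and>
    \<chi> \<cdot>\<^bsub>CS\<^esub> \<phi> x = amap G (incl_arrow (sub_F d FX gen Z) FX) \<cdot>\<^bsub>CS\<^esub> g" if x: "x \<in> nonmax d XX" for x
  proof (rule weakly_presented_factor[OF size lam supp FX cov G Sx_presented[OF x]])
    have "x \<in> XX" using x by (simp add: nonmax_def)
    then show "\<chi> \<cdot>\<^bsub>CS\<^esub> \<phi> x \<in> Hom CS (Sx x) (omap G FX)"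
      using CS.cmp_in[OF \<phi>_in \<chi>] by (simp add: G_simps)
  qed
  then obtain V \<psi> where V: "\<And>x. x \<in> nonmax d XX \<Longrightarrow> nabla_closed (V x)"
    "\<And>x. x \<in> nonmax d XX \<Longrightarrow> |V x| <o lam"
    and \<psi>: "\<And>x. x \<in> nonmax d XX \<Longrightarrow> \<psi> x \<in> Hom CS (Sx x) (omap G (sub_F d FX gen (V x)))"
    "\<And>x. x \<in> nonmax d XX \<Longrightarrow>
      \<chi> \<cdot>\<^bsub>CS\<^esub> \<phi> x = amap G (incl_arrow (sub_F d FX gen (V x)) FX) \<cdot>\<^bsub>CS\<^esub> \<psi> x"
    by metis
  \<comment> \<open>The supports \<open>V x\<close> of the factorizations are the small sets handed
    to the lifter.\<close>
  have "V ` nonmax d XX \<subseteq> small_subsets lam UNIV" using V(2) by (auto simp: small_subsets_def)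
  from lift[OF this] obtain \<sigma> where sec: "isotone_section d XX \<sigma>"
    and V\<sigma>: "\<And>a b. a < b \<Longrightarrow> V (\<sigma> a) \<inter> \<sigma> b \<subseteq> \<sigma> a" by metis
  have \<sigma>: "\<sigma> p \<in> XX" "ideal_norm d (\<sigma> p) = p" "p \<le> q \<Longrightarrow> \<sigma> p \<subseteq> \<sigma> q" for p q
    using sec by (auto simp: isotone_section_def mono_def)
  have \<alpha>_in: "\<alpha> p q \<in> Hom CA (A p) (A q)" if "p \<le> q" for p q
    by (rule A[unfolded diagram_def, THEN conjunct2, THEN conjunct1, rule_format, OF UNIV_I UNIV_I that])
  have comp_in: "\<rho> (\<sigma> p) \<cdot>\<^bsub>CS\<^esub> \<phi> (\<sigma> p) \<in> Hom CS (Sx (\<sigma> p)) (omap \<Phi> (A p))" for p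
    using CS.cmp_in[OF \<phi>_in[OF \<sigma>(1)] \<rho>_in[OF \<sigma>(1)]] unfolding \<sigma>(2) .

  have natural: "(\<rho> (\<sigma> q) \<cdot>\<^bsub>CS\<^esub> \<phi> (\<sigma> q)) \<cdot>\<^bsub>CS\<^esub> \<phi>\<phi> (\<sigma> p) (\<sigma> q)
      = amap \<Phi> (\<alpha> p q) \<cdot>\<^bsub>CS\<^esub> (\<rho> (\<sigma> p) \<cdot>\<^bsub>CS\<^esub> \<phi> (\<sigma> p))" if pq: "p < q" for p q
  proof -
    let ?x = "\<sigma> p" and ?y = "\<sigma> q"
    \<comment> \<open>The norm of \<open>\<sigma> p\<close> is \<open>p\<close>, which lies strictly
      below \<open>q\<close>; hence the factorization is available at
      \<open>\<sigma> p\<close>.\<close>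
    have x: "?x \<in> nonmax d XX" using \<sigma> pq by (auto simp: nonmax_def)
    note pq' = less_imp_le[OF pq]
    define B where "B = sub_F d FX gen (V ?x)"
    define \<iota> where "\<iota> = incl_arrow B FX"
    have FXU: "sub_F d FX gen UNIV = FX" by (rule sub_F_UNIV[OF FX cov])
    have \<iota>: "\<iota> \<in> Hom BoolP B FX"
      using FX.incl_arrow_in[OF V(1)[OF x], of UNIV] unfolding \<iota>_def B_def FXU by (simp add: nabla_closed_def)
    have T\<iota>: "amap T \<iota> \<in> Hom CA (omap T B) (omap T FX)" by (rule functor_in[OF T_functor(1) \<iota>])
    have \<psi>x: "\<psi> ?x \<in> Hom CS (Sx ?x) (omap \<Phi> (omap T B))"
      "\<chi> \<cdot>\<^bsub>CS\<^esub> \<phi> ?x = amap \<Phi> (amap T \<iota>) \<cdot>\<^bsub>CS\<^esub> \<psi> ?x"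
      using \<psi>[OF x] by (simp_all add: G_simps B_def \<iota>_def)
    have sx: "?x \<in> sharp_ideals d" and sy: "?y \<in> sharp_ideals d" using \<sigma>(1) sharp by auto
    note pix = pi_arrow_in[OF FX cov sx, unfolded \<sigma>(2)]
    let ?\<epsilon> = "incl_arrow (two p) (two q) :: ('u, 'p) scaled_arrow"
    let ?\<pi>\<iota> = "pi_arrow d FX gen ?x \<cdot>\<^bsub>BoolP\<^esub> \<iota>"
    have \<epsilon>: "?\<epsilon> \<in> Hom BoolP (two p) (two q)" by (rule incl_arrow_two_in[OF pq'])
    have prp: "pr (two r) 1 \<in> Hom CA (omap T (two r)) (A r)" for r by (rule condensate_two_proj[OF T])
    have \<pi>\<iota>: "?\<pi>\<iota> \<in> Hom BoolP B (two p)" by (rule cmp_BoolP_in[OF \<iota> pix])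
    have restrict: "pi_arrow d FX gen ?y \<cdot>\<^bsub>BoolP\<^esub> \<iota> = ?\<epsilon> \<cdot>\<^bsub>BoolP\<^esub> ?\<pi>\<iota>"
      using pi_arrow_restrict[OF FX cov sx sy _ \<sigma>(3)[OF pq'] V\<sigma>[OF pq] V(1)[OF x]] pq'
      unfolding \<sigma>(2) B_def \<iota>_def by simp
    have \<pi>_\<iota>: "\<pi> z \<cdot>\<^bsub>CA\<^esub> amap T \<iota> = pr (two (ideal_norm d z)) 1 \<cdot>\<^bsub>CA\<^esub> amap T (pi_arrow d FX gen z \<cdot>\<^bsub>BoolP\<^esub> \<iota>)"
      if "z \<in> sharp_ideals d" for z
      unfolding \<pi>_def functor_cmp[OF T_functor(1) \<iota> pi_arrow_in[OF FX cov that]]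
      by (rule CA.cmp_assoc[OF T\<iota> functor_in[OF T_functor(1) pi_arrow_in[OF FX cov that]] prp])
    have "\<pi> ?y \<cdot>\<^bsub>CA\<^esub> amap T \<iota> = pr (two q) 1 \<cdot>\<^bsub>CA\<^esub> (amap T ?\<epsilon> \<cdot>\<^bsub>CA\<^esub> amap T ?\<pi>\<iota>)"
      unfolding \<pi>_\<iota>[OF sy] restrict functor_cmp[OF T_functor(1) \<pi>\<iota> \<epsilon>] \<sigma>(2) ..
    also have "\<dots> = (pr (two q) 1 \<cdot>\<^bsub>CA\<^esub> amap T ?\<epsilon>) \<cdot>\<^bsub>CA\<^esub> amap T ?\<pi>\<iota>"
      by (rule CA.cmp_assoc[OF functor_in[OF T_functor(1) \<pi>\<iota>] functor_in[OF T_functor(1) \<epsilon>] prp, symmetric])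
    also have "\<dots> = (\<alpha> p q \<cdot>\<^bsub>CA\<^esub> pr (two p) 1) \<cdot>\<^bsub>CA\<^esub> amap T ?\<pi>\<iota>"
      unfolding condensate_two_arrow[OF T pq'] ..
    also have "\<dots> = \<alpha> p q \<cdot>\<^bsub>CA\<^esub> (\<pi> ?x \<cdot>\<^bsub>CA\<^esub> amap T \<iota>)"
      unfolding \<pi>_\<iota>[OF sx] \<sigma>(2)
      by (rule CA.cmp_assoc[OF functor_in[OF T_functor(1) \<pi>\<iota>] prp \<alpha>_in[OF pq']])
    finally have key: "\<pi> ?y \<cdot>\<^bsub>CA\<^esub> amap T \<iota> = \<alpha> p q \<cdot>\<^bsub>CA\<^esub> (\<pi> ?x \<cdot>\<^bsub>CA\<^esub> amap T \<iota>)" .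

    \<comment> \<open>The factorization concerns only \<open>\<chi>\<close> and
      \<open>\<phi> (\<sigma> p)\<close>, so the same \<open>\<psi> (\<sigma> p)\<close> works for
      every \<open>z\<close>. It is used below for both \<open>\<sigma> p\<close> and
      \<open>\<sigma> q\<close>.\<close>
    have \<rho>\<phi>: "\<rho> z \<cdot>\<^bsub>CS\<^esub> \<phi> ?x = amap \<Phi> (\<pi> z \<cdot>\<^bsub>CA\<^esub> amap T \<iota>) \<cdot>\<^bsub>CS\<^esub> \<psi> ?x" if z: "z \<in> XX" for z
    proof -
      have "\<rho> z \<cdot>\<^bsub>CS\<^esub> \<phi> ?x = amap \<Phi> (\<pi> z) \<cdot>\<^bsub>CS\<^esub> (\<chi> \<cdot>\<^bsub>CS\<^esub> \<phi> ?x)"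
        unfolding \<rho>_eq[OF z] by (rule CS.cmp_assoc[OF \<phi>_in[OF \<sigma>(1)] \<chi> \<Phi>\<pi>_in[OF z]])
      also have "\<dots> = (amap \<Phi> (\<pi> z) \<cdot>\<^bsub>CS\<^esub> amap \<Phi> (amap T \<iota>)) \<cdot>\<^bsub>CS\<^esub> \<psi> ?x"
        unfolding \<psi>x(2) by (rule CS.cmp_assoc[OF \<psi>x(1) functor_in[OF \<Phi> T\<iota>] \<Phi>\<pi>_in[OF z], symmetric])
      also have "\<dots> = amap \<Phi> (\<pi> z \<cdot>\<^bsub>CA\<^esub> amap T \<iota>) \<cdot>\<^bsub>CS\<^esub> \<psi> ?x"
        unfolding functor_cmp[OF \<Phi> T\<iota> \<pi>_in[OF z]] ..
      finally show ?thesis .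
    qed
    have \<pi>x\<iota>: "\<pi> ?x \<cdot>\<^bsub>CA\<^esub> amap T \<iota> \<in> Hom CA (omap T B) (A p)"
      using CA.cmp_in[OF T\<iota> \<pi>_in[OF \<sigma>(1)]] unfolding \<sigma>(2) .
    have "(\<rho> ?y \<cdot>\<^bsub>CS\<^esub> \<phi> ?y) \<cdot>\<^bsub>CS\<^esub> \<phi>\<phi> ?x ?y = \<rho> ?y \<cdot>\<^bsub>CS\<^esub> (\<phi> ?y \<cdot>\<^bsub>CS\<^esub> \<phi>\<phi> ?x ?y)"
      by (rule CS.cmp_assoc[OF \<phi>\<phi>(1)[OF \<sigma>(1,1) \<sigma>(3)[OF pq']] \<phi>_in[OF \<sigma>(1)] \<rho>_in[OF \<sigma>(1)]])
    also have "\<dots> = amap \<Phi> (\<alpha> p q \<cdot>\<^bsub>CA\<^esub> (\<pi> ?x \<cdot>\<^bsub>CA\<^esub> amap T \<iota>)) \<cdot>\<^bsub>CS\<^esub> \<psi> ?x"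
      \<comment> \<open>The triangle over \<open>S\<close> replaces the composite through
        \<open>Sx (\<sigma> q)\<close> by \<open>\<phi> (\<sigma> p)\<close>, so both sides are
        compared on the subalgebra for \<open>V (\<sigma> p)\<close>.\<close>
      unfolding \<phi>\<phi>(2)[OF \<sigma>(1,1) \<sigma>(3)[OF pq']] \<rho>\<phi>[OF \<sigma>(1)] key ..
    also have "\<dots> = amap \<Phi> (\<alpha> p q) \<cdot>\<^bsub>CS\<^esub> (\<rho> ?x \<cdot>\<^bsub>CS\<^esub> \<phi> ?x)"
      unfolding functor_cmp[OF \<Phi> \<pi>x\<iota> \<alpha>_in[OF pq']] \<rho>\<phi>[OF \<sigma>(1)]
      by (rule CS.cmp_assoc[OF \<psi>x(1) functor_in[OF \<Phi> \<pi>x\<iota>] functor_in[OF \<Phi> \<alpha>_in[OF pq']]])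
    finally show ?thesis .
  qed

  have "nat_trans CS UNIV (\<le>) (\<lambda>p. Sx (\<sigma> p)) (\<lambda>p q. \<phi>\<phi> (\<sigma> p) (\<sigma> q))
      (\<lambda>p. omap \<Phi> (A p)) (\<lambda>p q. amap \<Phi> (\<alpha> p q)) (\<lambda>p. \<rho> (\<sigma> p) \<cdot>\<^bsub>CS\<^esub> \<phi> (\<sigma> p))"
    unfolding nat_trans_def
  proof (intro conjI ballI impI)
    have "Sx x \<in> Ob CS" if "x \<in> XX" for x using CS.src_in[of "\<phi> x"] \<phi>_in[OF that] by (auto simp: Hom_def)
    then show "diagram CS UNIV (\<le>) (\<lambda>p. Sx (\<sigma> p)) (\<lambda>p q. \<phi>\<phi> (\<sigma> p) (\<sigma> q))"
      unfolding diagram_def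
      by (intro conjI ballI impI \<phi>\<phi>_id \<phi>\<phi>(1) \<phi>\<phi>_cmp \<sigma>(1,3)) (simp_all add: \<sigma>(1))
    show dia: "diagram CS UNIV (\<le>) (\<lambda>p. omap \<Phi> (A p)) (\<lambda>p q. amap \<Phi> (\<alpha> p q))"
      by (rule diagram_functor[OF \<Phi> A])
    fix p q :: 'p
    show "\<rho> (\<sigma> p) \<cdot>\<^bsub>CS\<^esub> \<phi> (\<sigma> p) \<in> Hom CS (Sx (\<sigma> p)) (omap \<Phi> (A p))" by (rule comp_in)
    assume "p \<le> q"
    \<comment> \<open>The case \<open>p = q\<close> includes maximal \<open>p\<close>, where no
      factorization is given; there both transition arrows are identities.\<close>
    then consider "p < q" | "p = q" by (auto simp: order.order_iff_strict)
    then show "(\<rho> (\<sigma> q) \<cdot>\<^bsub>CS\<^esub> \<phi> (\<sigma> q)) \<cdot>\<^bsub>CS\<^esub> \<phi>\<phi> (\<sigma> p) (\<sigma> q)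
      = amap \<Phi> (\<alpha> p q) \<cdot>\<^bsub>CS\<^esub> (\<rho> (\<sigma> p) \<cdot>\<^bsub>CS\<^esub> \<phi> (\<sigma> p))"
    proof cases
      case 1
      then show ?thesis by (rule natural)
    next
      case 2
      have "amap \<Phi> (\<alpha> p p) = ident CS (omap \<Phi> (A p))"
        by (rule dia[unfolded diagram_def, THEN conjunct1, rule_format, OF UNIV_I, THEN conjunct2])
      then show ?thesis
        using 2 \<phi>\<phi>_id[OF \<sigma>(1)] CS.ident_left[OF comp_in] CS.ident_right[OF comp_in] by simp
    qed
  qed
  with sec show ?thesis by blast
qed

end
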